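(* Let $S$ be a compact, connected, boundaryless smooth Riemannian surface with an area form, and let $\lambda$ be the induced measure. The function $$\Lambda\colon \mathrm{Hom}_\lambda(S)\longrightarrow[0,+\infty[,\qquad \Lambda(h)=\int_S\chi^+_N(h,x)\,d\lambda(x),$$ where $\mathrm{Hom}_\lambda(S)$ is endowed with the $C^0$ topology and $\chi^+_N$ is the top new Lyapunov exponent, is not upper-semicontinuous.
   Context: $\mathrm{Hom}_\lambda(S)$ is the set of homeomorphisms $h$ of $S$ with $\lambda(h(B))=\lambda(B)$ for every Borel set $B$, endowed with the $C^0$ topology given by the metric $d(f,g):=\sup\{d(f(x),g(x)),\,d(f^{-1}(x),g^{-1}(x)) : x\in S\}$, where $d$ on the right is the distance on $S$. Charts. Fix a finite atlas $\{\varphi_i\colon U_i\to\mathbb{R}^2\}_{i=1}^k$ of $S$ with $U_i\subset S$ open, whose charts are conservative (area-preserving; such an atlas exists by compactness and Darboux's theorem). For $x\in S$ put $i(x):=\min\{i : x\in U_i\}$. Computations are performed in Euclidean space via these fixed charts. Dynamical balls. For continuous $f\colon S\to S$, $x\in S$, $\delta>0$, $n\in\mathbb{N}$, $$B_x(\delta,n):=\{y\in S : d(f^j(x),f^j(y))<\delta \text{ for } j=0,1,\dots,n\}.$$ Difference quotients. $\Delta(f,n,x,y):=\dfrac{\|f^n(x)-f^n(y)\|}{\|x-y\|}$ with Euclidean norm, where differences are computed in the charts: $x-y$ means $\varphi_{i(x)}(x)-\varphi_{i(x)}(y)$ and $f^n(x)-f^n(y)$ means $\varphi_{i(f^n(x))}(f^n(x))-\varphi_{i(f^n(x))}(f^n(y))$;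 for fixed $x$ and $n$ this makes sense for all $y\in B_x(\delta,n)\setminus\{x\}$ once $\delta$ is small enough. Top new Lyapunov exponent: $$\chi^+_N(f,x):=\limsup_{n\to+\infty}\ \lim_{\delta\to0}\ \frac1n\log\sup_{y\in B_x(\delta,n)\setminus\{x\}}\Delta(f,n,x,y).$$
   Formalization: The codomain [0,+∞[ is replaced by the extended reals, because some area-preserving homeomorphisms (twists of a disc by a nowhere-Lipschitz angle) have Λ = +∞; failure of upper semicontinuity is proved for this extended-valued Λ. *)

theory Defs
  imports "HOL-Analysis.Analysis"
begin

text \<open>A surface is the whole of a topological type \<open>'a\<close>. A chart is a pair \<open>(U, \<phi>)\<close>;
  the values of \<open>\<phi>\<close> outside \<open>U\<close> are irrelevant.\<close>

type_synonym 'a chart = "'a set \<times> ('a \<Rightarrow> real^2)"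

primrec ck_on ::
    "nat \<Rightarrow> ('b::real_normed_vector \<Rightarrow> 'c::real_normed_vector) \<Rightarrow> 'b set \<Rightarrow> bool" where
  "ck_on 0 f W \<longleftrightarrow> continuous_on W f"
| "ck_on (Suc k) f W \<longleftrightarrow>
     f differentiable_on W \<and> (\<forall>v. ck_on k (\<lambda>x. frechet_derivative f (at x) v) W)"

text \<open>\<open>C\<^sup>\<infinity>\<close> on \<open>W\<close>; only meaningful, and only used, for open \<open>W\<close>.\<close>

definition smooth_on :: "('b::real_normed_vector \<Rightarrow> 'c::real_normed_vector) \<Rightarrow> 'b set \<Rightarrow> bool" where
  "smooth_on f W \<longleftrightarrow> (\<forall>k. ck_on k f W)"

definition is_chart :: "'a::topological_space chart \<Rightarrow> bool" where
  "is_chart c \<longleftrightarrow> open (fst c) \<and> open (snd c ` fst c) \<and>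
     homeomorphism (fst c) (snd c ` fst c) (snd c) (inv_into (fst c) (snd c))"

definition transition :: "'a chart \<Rightarrow> 'a chart \<Rightarrow> real^2 \<Rightarrow> real^2" where
  "transition c c' = snd c' \<circ> inv_into (fst c) (snd c)"

definition compatible :: "'a chart \<Rightarrow> 'a chart \<Rightarrow> bool" where
  "compatible c c' \<longleftrightarrow>
     smooth_on (transition c c') (snd c ` (fst c \<inter> fst c')) \<and>
     smooth_on (transition c' c) (snd c' ` (fst c \<inter> fst c'))"

definition smooth_atlas :: "'a::topological_space chart set \<Rightarrow> bool" where
  "smooth_atlas \<A> \<longleftrightarrow>
     (\<forall>c\<in>\<A>. is_chart c) \<and> (\<Union>c\<in>\<A>. fst c) = UNIV \<and> (\<forall>c\<in>\<A>. \<forall>c'\<in>\<A>. compatible c c')"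

text \<open>Membership in the maximal atlas generated by \<open>\<A>\<close>.\<close>

definition smooth_chart :: "'a::topological_space chart set \<Rightarrow> 'a chart \<Rightarrow> bool" where
  "smooth_chart \<A> c \<longleftrightarrow> is_chart c \<and> (\<forall>c'\<in>\<A>. compatible c c')"

text \<open>Tensors are given by their component functions in the charts of \<open>\<A>\<close>, subject to the usual
  transformation rule: \<open>G c u\<close> is the Gram matrix of the metric in the chart \<open>c\<close> at coordinates
  \<open>u\<close>, and \<open>\<omega> c u\<close> is the coefficient of \<open>du\<^sub>1 \<and> du\<^sub>2\<close>.\<close>

definition riemannian_metric ::
    "'a chart set \<Rightarrow> ('a chart \<Rightarrow> real^2 \<Rightarrow> real^2^2) \<Rightarrow> bool" where
  "riemannian_metric \<A> G \<longleftrightarrow>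
     (\<forall>c\<in>\<A>. smooth_on (G c) (snd c ` fst c) \<and>
        (\<forall>u \<in> snd c ` fst c.
           transpose (G c u) = G c u \<and> (\<forall>v. v \<noteq> 0 \<longrightarrow> v \<bullet> (G c u *v v) > 0))) \<and>
     (\<forall>c\<in>\<A>. \<forall>c'\<in>\<A>. \<forall>p \<in> fst c \<inter> fst c'. \<forall>v w.
        let D = frechet_derivative (transition c c') (at (snd c p)) in
        v \<bullet> (G c (snd c p) *v w) = D v \<bullet> (G c' (snd c' p) *v D w))"

definition area_form :: "'a chart set \<Rightarrow> ('a chart \<Rightarrow> real^2 \<Rightarrow> real) \<Rightarrow> bool" where
  "area_form \<A> \<omega> \<longleftrightarrow>
     (\<forall>c\<in>\<A>. smooth_on (\<omega> c) (snd c ` fst c) \<and> (\<forall>u \<in> snd c ` fst c. \<omega> c u \<noteq> 0)) \<and>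
     (\<forall>c\<in>\<A>. \<forall>c'\<in>\<A>. \<forall>p \<in> fst c \<inter> fst c'.
        \<omega> c (snd c p) =
        det (matrix (frechet_derivative (transition c c') (at (snd c p)))) * \<omega> c' (snd c' p))"

text \<open>This determines \<open>M\<close> uniquely on a compact surface.\<close>

definition induced_measure ::
    "'a::topological_space chart set \<Rightarrow> ('a chart \<Rightarrow> real^2 \<Rightarrow> real) \<Rightarrow> 'a measure \<Rightarrow> bool" where
  "induced_measure \<A> \<omega> M \<longleftrightarrow> sets M = sets borel \<and>
     (\<forall>c\<in>\<A>. \<forall>B\<in>sets borel. B \<subseteq> fst c \<longrightarrow>
        emeasure M B = (\<integral>\<^sup>+ u \<in> snd c ` B. ennreal \<bar>\<omega> c u\<bar> \<partial>lborel))"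

definition piecewise_C1_curve ::
    "'a::topological_space chart set \<Rightarrow> (real \<Rightarrow> 'a) \<Rightarrow> bool" where
  "piecewise_C1_curve \<A> \<gamma> \<longleftrightarrow> continuous_on {0..1} \<gamma> \<and>
     (\<forall>c\<in>\<A>. \<forall>a b. 0 \<le> a \<and> b \<le> 1 \<and> \<gamma> ` {a..b} \<subseteq> fst c \<longrightarrow>
        (snd c \<circ> \<gamma>) piecewise_C1_differentiable_on {a..b})"

text \<open>By the transformation rule of the metric, the speed does not depend on the chart chosen.\<close>

definition speed ::
    "'a chart set \<Rightarrow> ('a chart \<Rightarrow> real^2 \<Rightarrow> real^2^2) \<Rightarrow> (real \<Rightarrow> 'a) \<Rightarrow> real \<Rightarrow> real" where
  "speed \<A> G \<gamma> t =
     (let c = (SOME c. c \<in> \<A> \<and> \<gamma> t \<in> fst c);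
          v = vector_derivative (snd c \<circ> \<gamma>) (at t)
      in sqrt (v \<bullet> (G c (snd c (\<gamma> t)) *v v)))"

definition curve_length ::
    "'a chart set \<Rightarrow> ('a chart \<Rightarrow> real^2 \<Rightarrow> real^2^2) \<Rightarrow> (real \<Rightarrow> 'a) \<Rightarrow> ennreal" where
  "curve_length \<A> G \<gamma> = (\<integral>\<^sup>+ t \<in> {0..1}. ennreal (speed \<A> G \<gamma> t) \<partial>lborel)"

definition rdist ::
    "'a::topological_space chart set \<Rightarrow> ('a chart \<Rightarrow> real^2 \<Rightarrow> real^2^2) \<Rightarrow> 'a \<Rightarrow> 'a \<Rightarrow> real" where
  "rdist \<A> G x y =
     enn2real (INF \<gamma> \<in> {\<gamma>. piecewise_C1_curve \<A> \<gamma> \<and> \<gamma> 0 = x \<and> \<gamma> 1 = y}. curve_length \<A> G \<gamma>)"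

definition Hom :: "'a::topological_space measure \<Rightarrow> ('a \<Rightarrow> 'a) set" where
  "Hom M = {h. homeomorphism UNIV UNIV h (inv h) \<and>
     (\<forall>B\<in>sets borel. emeasure M (h ` B) = emeasure M B)}"

text \<open>In the following, \<open>d\<close> is the distance on the surface.\<close>

definition C0_dist :: "('a \<Rightarrow> 'a \<Rightarrow> real) \<Rightarrow> ('a \<Rightarrow> 'a) \<Rightarrow> ('a \<Rightarrow> 'a) \<Rightarrow> real" where
  "C0_dist d f g = (SUP x. max (d (f x) (g x)) (d (inv f x) (inv g x)))"

definition Hom_topology ::
    "('a \<Rightarrow> 'a \<Rightarrow> real) \<Rightarrow> 'a::topological_space measure \<Rightarrow> ('a \<Rightarrow> 'a) topology" where
  "Hom_topology d M = Metric_space.mtopology (Hom M) (C0_dist d)"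

text \<open>Area-preserving charts may reverse the orientation. The order of the list matters, since
  \<open>chart_at\<close> picks the first chart containing the point.\<close>

definition conservative_atlas ::
    "'a::topological_space chart set \<Rightarrow> 'a measure \<Rightarrow> 'a chart list \<Rightarrow> bool" where
  "conservative_atlas \<A> M \<Phi> \<longleftrightarrow> (\<Union>c\<in>set \<Phi>. fst c) = UNIV \<and>
     (\<forall>c\<in>set \<Phi>. smooth_chart \<A> c \<and>
        (\<forall>B\<in>sets borel. B \<subseteq> fst c \<longrightarrow> emeasure lborel (snd c ` B) = emeasure M B))"

definition chart_at :: "'a chart list \<Rightarrow> 'a \<Rightarrow> 'a \<Rightarrow> real^2" where
  "chart_at \<Phi> x = snd (\<Phi> ! (LEAST i. i < length \<Phi> \<and> x \<in> fst (\<Phi> ! i)))"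

definition dynamical_ball ::
    "('a \<Rightarrow> 'a \<Rightarrow> real) \<Rightarrow> ('a \<Rightarrow> 'a) \<Rightarrow> 'a \<Rightarrow> real \<Rightarrow> nat \<Rightarrow> 'a set" where
  "dynamical_ball d f x \<delta> n = {y. \<forall>j\<le>n. d ((f ^^ j) x) ((f ^^ j) y) < \<delta>}"

text \<open>Only meaningful for \<open>y\<close> close to \<open>x\<close>, so that the charts at \<open>x\<close> and at its image are
  defined at \<open>y\<close> and at its image; the limit \<open>\<delta> \<rightarrow> 0\<close> in \<open>top_exponent\<close> sees no other \<open>y\<close>.\<close>

definition diff_quot :: "'a chart list \<Rightarrow> ('a \<Rightarrow> 'a) \<Rightarrow> nat \<Rightarrow> 'a \<Rightarrow> 'a \<Rightarrow> real" where
  "diff_quot \<Phi> f n x y =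
     norm (chart_at \<Phi> ((f ^^ n) x) ((f ^^ n) x) - chart_at \<Phi> ((f ^^ n) x) ((f ^^ n) y)) /
     norm (chart_at \<Phi> x x - chart_at \<Phi> x y)"

definition elog :: "ereal \<Rightarrow> ereal" where
  "elog x = (if x \<le> 0 then -\<infinity> else if x = \<infinity> then \<infinity> else ereal (ln (real_of_ereal x)))"

text \<open>The limit \<open>\<delta> \<rightarrow> 0\<close> always exists in the extended reals, by monotonicity.\<close>

definition top_exponent ::
    "('a \<Rightarrow> 'a \<Rightarrow> real) \<Rightarrow> 'a chart list \<Rightarrow> ('a \<Rightarrow> 'a) \<Rightarrow> 'a \<Rightarrow> ereal" where
  "top_exponent d \<Phi> f x =
     limsup (\<lambda>n. Lim (at_right 0) (\<lambda>\<delta>. ereal (1 / real n) *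
       elog (SUP y \<in> dynamical_ball d f x \<delta> n - {x}. ereal (diff_quot \<Phi> f n x y))))"

text \<open>Integral of the positive part minus integral of the negative part.\<close>

definition ereal_integral :: "'b measure \<Rightarrow> ('b \<Rightarrow> ereal) \<Rightarrow> ereal" where
  "ereal_integral M f =
     enn2ereal (\<integral>\<^sup>+ x. e2ennreal (f x) \<partial>M) - enn2ereal (\<integral>\<^sup>+ x. e2ennreal (- f x) \<partial>M)"

text \<open>The exponent of a conservative homeomorphism is nonnegative almost everywhere but can be
  infinite on a set of positive measure, so the integrated exponent is extended-real-valued.\<close>

definition integrated_exponent ::
    "('a \<Rightarrow> 'a \<Rightarrow> real) \<Rightarrow> 'a chart list \<Rightarrow> 'a measure \<Rightarrow> ('a \<Rightarrow> 'a) \<Rightarrow> ereal" where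
  "integrated_exponent d \<Phi> M h = ereal_integral M (top_exponent d \<Phi> h)"

definition upper_semicontinuous_map :: "'b topology \<Rightarrow> ('b \<Rightarrow> 'c::linorder) \<Rightarrow> bool" where
  "upper_semicontinuous_map X F \<longleftrightarrow> (\<forall>a. openin X {x \<in> topspace X. F x < a})"

end

theory Submission
  imports Defs
begin

text \<open>The identity has integrated exponent \<open>0\<close>. In an arbitrarily small disc, given in polar
  coordinates of an area-preserving chart, consider the twist \<open>(r, \<theta>) \<mapsto> (r, \<theta> + w r)\<close> with
  \<open>w\<close> continuous, zero from the boundary radius on, and not Lipschitz at any smaller radius. It is a
  conservative homeomorphism that moves points only within the disc, hence is \<open>C\<^sup>0\<close>-close to
  the identity. Its \<open>n\<close>-th iterate is the twist by \<open>n * w\<close>, which is not Lipschitz at any point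
  of the punctured open disc either, so there the exponent is infinite.\<close>

section \<open>A continuous nowhere Lipschitz function\<close>

text \<open>The profile has to be so rough that no Jacobian is available for the twist. Area
  preservation is therefore drawn from the rotation invariance of Lebesgue measure and an exchange
  of integrals, which ask only for continuity of \<open>w\<close>. In return, roughness replaces
  dynamics: the difference quotients are already unbounded for each single \<open>n \<ge> 1\<close>
  in every dynamical ball, so no growth rate has to be computed, and an infinite value on a set of
  positive measure makes the integral infinite. Most of the remaining work concerns the topology.
  Open sets of \<open>Hom_topology\<close> can be described by balls only once
  \<open>C0_dist\<close> is known to be a metric. This requires that the infimum of curve lengths is
  finite, symmetric, positive and subadditive, and that it is small along short segments in a
  chart.\<close>

lemma abs_cos_diff_le: "\<bar>cos x - cos y\<bar> \<le> \<bar>x - y\<bar>" for x y :: real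
proof -
  have "\<bar>cos x - cos y\<bar> = 2 * \<bar>sin ((x + y) / 2)\<bar> * \<bar>sin ((y - x) / 2)\<bar>"
    by (simp add: cos_diff_cos abs_mult)
  also have "\<dots> \<le> 2 * 1 * \<bar>(y - x) / 2\<bar>"
    by (intro mult_mono abs_sin_le_one abs_sin_x_le_abs_x) auto
  finally show ?thesis by simp
qed

text \<open>The two multiples of \<open>pi\<close> enclosing \<open>t\<close> carry the cosine
  values 1 and -1, and no real number is closer than 1 to both.\<close>

lemma cos_moves_by_one: "\<exists>s. \<bar>s - t\<bar> \<le> pi \<and> 1 \<le> \<bar>cos s - cos t\<bar>" for t :: real
proof -
  define k where "k = \<lfloor>t / pi\<rfloor>"
  have "of_int k \<le> t / pi" "t / pi < of_int k + 1"
    unfolding k_def by linarith+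
  then have k: "of_int k * pi \<le> t" "t \<le> (of_int k + 1) * pi"
    by (simp_all add: field_simps)
  have "cos (of_int (k + 1) * pi) = - cos (of_int k * pi)"
    by (simp add: distrib_right)
  moreover have "\<bar>cos (of_int k * pi)\<bar> = 1"
    by (intro sin_zero_abs_cos_one) (simp add: sin_times_pi_eq_0)
  ultimately have "1 \<le> \<bar>cos (of_int k * pi) - cos t\<bar> \<or> 1 \<le> \<bar>cos (of_int (k + 1) * pi) - cos t\<bar>"
    by arith
  then obtain j where "j = k \<or> j = k + 1" and j: "1 \<le> \<bar>cos (of_int j * pi) - cos t\<bar>"
    by blast
  then have "\<bar>of_int j * pi - t\<bar> \<le> pi"
    using k by (auto simp: abs_le_iff algebra_simps)
  with j show ?thesis by blast
qed

text \<open>The Weierstrass function \<open>\<Sum>n. cos (128 ^ n * x) / 8 ^ n\<close>: at scale \<open>1 / 128 ^ m\<close> the \<open>m\<close>-th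
  term moves by at least \<open>1 / 8 ^ m\<close>, which neither the lower frequencies nor the small tail can
  compensate.\<close>

lemma exists_continuous_nowhere_Lipschitz:
  obtains W :: "real \<Rightarrow> real" where "continuous_on UNIV W"
    and "\<And>x K e. e > 0 \<Longrightarrow> \<exists>y. \<bar>y - x\<bar> < e \<and> K * \<bar>y - x\<bar> < \<bar>W y - W x\<bar>"
proof
  define f :: "nat \<Rightarrow> real \<Rightarrow> real" where "f n x = (1/8) ^ n * cos (128 ^ n * x)" for n x
  define W where "W x = (\<Sum>n. f n x)" for x
  have f_le: "norm (f n x) \<le> (1/8) ^ n" for n x
    by (simp add: f_def abs_mult mult_left_le)
  have geo: "summable (\<lambda>n. (1/8::real) ^ n)"
    by (rule summable_geometric) simp
  have sum_f: "summable (\<lambda>n. f n x)" for x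
    by (rule summable_comparison_test'[OF geo]) (rule f_le)
  have "uniform_limit UNIV (\<lambda>n x. \<Sum>i<n. f i x) (\<lambda>x. \<Sum>i. f i x) sequentially"
    by (rule Weierstrass_m_test[OF _ geo]) (rule f_le)
  moreover have "continuous_on UNIV (\<lambda>x. \<Sum>i<n. f i x)" for n
    unfolding f_def by (intro continuous_intros)
  ultimately show "continuous_on UNIV W"
    unfolding W_def by (intro uniform_limit_theorem[of _ "\<lambda>n x. \<Sum>i<n. f i x" sequentially]) auto
  fix x K e :: real assume "e > 0"
  have "\<forall>\<^sub>F m in sequentially. 10 * \<bar>K\<bar> < 16 ^ m"
    by real_asymp
  moreover have "\<forall>\<^sub>F m in sequentially. 4 / 128 ^ m < e"
    using \<open>e > 0\<close> by real_asymp
  \<comment> \<open>In units of \<open>(1/8) ^ m\<close>, the increment of \<open>W\<close> will be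
    at least \<open>1 - 2/7 - 4/15 = 47/105\<close> (term \<open>m\<close> minus tail and head),
    while \<open>10 * \<bar>K\<bar> < 16 ^ m\<close> keeps \<open>K * \<bar>y - x\<bar>\<close> at
    or below \<open>2/5 = 42/105\<close>. The 4 is a bound for \<open>pi\<close>.\<close>
  ultimately obtain m where m: "10 * \<bar>K\<bar> < 16 ^ m" "4 / 128 ^ m < e"
    by (metis (mono_tags, lifting) eventually_conj eventually_happens' sequentially_bot)
  obtain s where s: "\<bar>s - 128 ^ m * x\<bar> \<le> pi" "1 \<le> \<bar>cos s - cos (128 ^ m * x)\<bar>"
    using cos_moves_by_one by blast
  define y where "y = s / 128 ^ m"
  have s_eq: "s = 128 ^ m * y" by (simp add: y_def)
  have "\<bar>y - x\<bar> * 128 ^ m = \<bar>s - 128 ^ m * x\<bar>"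
    by (simp add: s_eq abs_mult flip: right_diff_distrib)
  with s(1) pi_less_4 have yx: "\<bar>y - x\<bar> < 4 / 128 ^ m"
    by (simp add: field_simps)
  define g where "g n = f n y - f n x" for n
  have sg: "summable g"
    unfolding g_def by (intro summable_diff sum_f)
  have "W y - W x = suminf g"
    unfolding W_def g_def by (rule suminf_diff) (rule sum_f)+
  also have "\<dots> = (\<Sum>n. g (n + Suc m)) + (\<Sum>n<m. g n) + g m"
    by (subst suminf_split_initial_segment[OF sg, of "Suc m"]) simp
  finally have split: "W y - W x = (\<Sum>n. g (n + Suc m)) + (\<Sum>n<m. g n) + g m" .
  have "(\<lambda>n. 2 * (1/8::real) ^ Suc m * (1/8) ^ n) sums (2 * (1/8) ^ Suc m * (1 / (1 - 1/8)))"
    by (intro sums_mult geometric_sums) simp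
  moreover have "norm (g (n + Suc m)) \<le> 2 * (1/8) ^ Suc m * (1/8) ^ n" for n
    using norm_triangle_ineq4[of "f (n + Suc m) y" "f (n + Suc m) x"]
      f_le[of "n + Suc m" y] f_le[of "n + Suc m" x]
    by (simp add: g_def power_add mult.commute)
  ultimately have "norm (\<Sum>n. g (n + Suc m)) \<le> 2 * (1/8) ^ Suc m * (1 / (1 - 1/8))"
    by (metis norm_suminf_le sums_iff)
  then have tail: "\<bar>\<Sum>n. g (n + Suc m)\<bar> \<le> 2/7 * (1/8) ^ m"
    by simp
  \<comment> \<open>The \<open>n\<close>-th term has Lipschitz constant
    \<open>(128 / 8) ^ n\<close>, so the lower frequencies together contribute at most
    \<open>16 ^ m / 15\<close> times \<open>\<bar>y - x\<bar>\<close>.\<close>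
  have "\<bar>g n\<bar> \<le> 16 ^ n * \<bar>y - x\<bar>" for n
  proof -
    have "\<bar>g n\<bar> = (1/8) ^ n * \<bar>cos (128 ^ n * y) - cos (128 ^ n * x)\<bar>"
      by (simp add: g_def f_def abs_mult flip: right_diff_distrib)
    also have "\<dots> \<le> (1/8) ^ n * \<bar>128 ^ n * y - 128 ^ n * x\<bar>"
      by (intro mult_left_mono abs_cos_diff_le) simp
    also have "\<dots> = ((1/8) ^ n * 128 ^ n) * \<bar>y - x\<bar>"
      by (simp add: abs_mult flip: right_diff_distrib)
    also have "(1/8) ^ n * 128 ^ n = (16::real) ^ n"
      by (simp flip: power_mult_distrib)
    finally show ?thesis .
  qed
  then have "\<bar>\<Sum>n<m. g n\<bar> \<le> (\<Sum>n<m. 16 ^ n * \<bar>y - x\<bar>)"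
    by (intro order_trans[OF sum_abs sum_mono])
  also have "\<dots> = (16 ^ m - 1) / 15 * \<bar>y - x\<bar>"
    by (simp add: geometric_sum flip: sum_distrib_right)
  also have "\<dots> \<le> 16 ^ m / 15 * (4 / 128 ^ m)"
    using yx by (intro mult_mono) (auto simp: field_simps)
  also have "\<dots> = 4/15 * (1/8) ^ m"
    by (simp add: power_divide field_simps flip: power_mult_distrib)
  finally have head: "\<bar>\<Sum>n<m. g n\<bar> \<le> 4/15 * (1/8) ^ m" .
  have "\<bar>g m\<bar> = (1/8) ^ m * \<bar>cos s - cos (128 ^ m * x)\<bar>"
    by (simp add: g_def f_def s_eq abs_mult flip: right_diff_distrib)
  then have mid: "(1/8) ^ m \<le> \<bar>g m\<bar>"
    using mult_left_mono[OF s(2), of "(1/8) ^ m"] by simp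
  have "K * \<bar>y - x\<bar> \<le> \<bar>K\<bar> * (4 / 128 ^ m)"
    using yx by (intro mult_mono) auto
  also have "\<dots> \<le> 16 ^ m / 10 * (4 / 128 ^ m)"
    using m(1) by (intro mult_right_mono) auto
  also have "\<dots> = 2/5 * (1/8) ^ m"
    by (simp add: power_divide field_simps flip: power_mult_distrib)
  also have "\<dots> < \<bar>W y - W x\<bar>"
    using split tail head mid zero_less_power[of "1/8::real" m] by linarith
  finally show "\<exists>y. \<bar>y - x\<bar> < e \<and> K * \<bar>y - x\<bar> < \<bar>W y - W x\<bar>"
    using yx m(2) by (intro exI[of _ y]) auto
qed

section \<open>Twists of the plane\<close>

text \<open>In the complex plane this is multiplication by the imaginary unit, so
  \<open>rot t\<close> is multiplication by \<open>exp (i * t)\<close>.\<close>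

definition quarter :: "real^2 \<Rightarrow> real^2" where
  "quarter u = vector [- u $ 2, u $ 1]"

definition rot :: "real \<Rightarrow> real^2 \<Rightarrow> real^2" where
  "rot t u = cos t *\<^sub>R u + sin t *\<^sub>R quarter u"

lemma rot_nth [simp]:
  "rot t u $ 1 = cos t * u $ 1 - sin t * u $ 2"
  "rot t u $ 2 = cos t * u $ 2 + sin t * u $ 1"
  by (simp_all add: rot_def quarter_def)

lemma rot_zero [simp]: "rot 0 u = u"
  by (simp add: rot_def)

lemma rot_rot: "rot s (rot t u) = rot (s + t) u"
  by (simp add: vec_eq_iff forall_2 cos_add sin_add algebra_simps)

lemma rot_2pi [simp]: "rot (t + 2 * pi) u = rot t u"
  by (simp add: rot_def)

lemma linear_rot: "linear (rot t)"
  by (rule linearI) (simp_all add: vec_eq_iff forall_2 algebra_simps)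

lemma norm_rot [simp]: "norm (rot t u) = norm u"
proof -
  have "(cos t * u $ 1 - sin t * u $ 2)\<^sup>2 + (cos t * u $ 2 + sin t * u $ 1)\<^sup>2
      = ((sin t)\<^sup>2 + (cos t)\<^sup>2) * ((u $ 1)\<^sup>2 + (u $ 2)\<^sup>2)"
    by algebra
  then show ?thesis by (simp add: norm_vec_def L2_set_def sum_2)
qed

lemma continuous_on_rot [continuous_intros]:
  fixes f :: "'a::t2_space \<Rightarrow> real"
  assumes "continuous_on S f" "continuous_on S g"
  shows "continuous_on S (\<lambda>x. rot (f x) (g x))"
proof -
  have *: "rot t u = (\<chi> i. if i = 1 then cos t * u $ 1 - sin t * u $ 2 else cos t * u $ 2 + sin t * u $ 1)" for t u
    by (simp add: vec_eq_iff forall_2)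
  have "continuous_on S (\<lambda>x. if i = 1 then cos (f x) * g x $ 1 - sin (f x) * g x $ 2
      else cos (f x) * g x $ 2 + sin (f x) * g x $ 1)" for i :: 2
    using assms by (cases "i = 1") (auto intro!: continuous_intros)
  then show ?thesis
    unfolding * by (intro continuous_on_vec_lambda)
qed

text \<open>Joint measurability in angle and vector is what the exchange of integrals in the
  averaging argument requires.\<close>

lemma borel_measurable_rot [measurable (raw)]:
  assumes [measurable]: "f \<in> borel_measurable M" "g \<in> borel_measurable M"
  shows "(\<lambda>x. rot (f x) (g x)) \<in> borel_measurable M"
proof -
  have "rot (pi / 2) \<in> borel_measurable borel"
    by (intro borel_measurable_continuous_onI continuous_intros)
  then have [measurable]: "quarter \<in> borel_measurable borel"
    by (simp add: rot_def cong: measurable_cong)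
  show ?thesis unfolding rot_def by measurable
qed

lemma rot_vimage: "rot t -` S = rot (- t) ` S"
  by (force simp: rot_rot image_iff)

text \<open>It suffices to test boxes. The preimage of a box is its image under the inverse
  rotation, and orthogonal maps preserve volume.\<close>

lemma distr_lborel_rot: "distr lborel borel (rot t) = lborel"
proof (rule lborel_eqI[symmetric])
  fix l u :: "real^2"
  assume le: "\<And>b. b \<in> Basis \<Longrightarrow> l \<bullet> b \<le> u \<bullet> b"
  have orth: "orthogonal_transformation (rot (- t))"
    using linear_rot by (simp add: orthogonal_transformation)
  have "emeasure (distr lborel borel (rot t)) (box l u) = emeasure lborel (rot (- t) ` box l u)"
    by (subst emeasure_distr) (auto simp: rot_vimage)
  also have "\<dots> = emeasure lebesgue (rot (- t) ` box l u)"
    using measurable_sets_borel[of "rot t" borel "box l u"]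
    by (simp add: rot_vimage)
  also have "\<dots> = measure lebesgue (rot (- t) ` box l u)"
    by (rule emeasure_eq_measure2) (use measurable_orthogonal_image[OF orth] in auto)
  also have "\<dots> = measure lebesgue (box l u)"
    using measure_orthogonal_image[OF orth] by simp
  also have "\<dots> = (\<Prod>b\<in>Basis. (u - l) \<bullet> b)"
    using le by (simp add: measure_lborel_box_eq measure_completion)
  finally show "emeasure (distr lborel borel (rot t)) (box l u) = (\<Prod>b\<in>Basis. (u - l) \<bullet> b)" .
qed simp

text \<open>The shift may be reduced modulo \<open>p\<close> to some \<open>d\<close> in
  \<open>{0..<p}\<close>. The translated period \<open>{d..<p + d}\<close> is then cut at
  \<open>p\<close>, and the part beyond \<open>p\<close> is moved back by one period.\<close>

lemma nn_integral_periodic_shift: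
  fixes F :: "real \<Rightarrow> ennreal"
  assumes [measurable]: "F \<in> borel_measurable borel" and "p > 0" and per: "\<And>t. F (t + p) = F t"
  shows "(\<integral>\<^sup>+ t. F (t + c) * indicator {0..<p} t \<partial>lborel) = (\<integral>\<^sup>+ t. F t * indicator {0..<p} t \<partial>lborel)"
proof -
  interpret F: periodic_fun_simple F p
    using per by unfold_locales
  define d where "d = c - of_int \<lfloor>c / p\<rfloor> * p"
  have d: "0 \<le> d" "d < p"
    using floor_divide_lower[OF \<open>p > 0\<close>, of c] floor_divide_upper[OF \<open>p > 0\<close>, of c]
    by (auto simp: d_def algebra_simps)
  have Fc: "F (t + c) = F (t + d)" for t
    using F.plus_of_int[of "t + d" "\<lfloor>c / p\<rfloor>"] by (simp add: d_def algebra_simps)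
  have shift: "(\<integral>\<^sup>+ t. H t \<partial>lborel) = (\<integral>\<^sup>+ t. H (t + a) \<partial>lborel)"
    if [measurable]: "H \<in> borel_measurable borel" for H :: "real \<Rightarrow> ennreal" and a
    using nn_integral_real_affine[of H 1 a] by (simp add: add.commute)
  have "(\<integral>\<^sup>+ t. F (t + d) * indicator {0..<p} t \<partial>lborel)
      = (\<integral>\<^sup>+ t. F t * indicator {d..<p + d} t \<partial>lborel)"
    by (subst (2) shift[of _ d]) (auto intro!: nn_integral_cong split: split_indicator)
  also have "\<dots> = (\<integral>\<^sup>+ t. F t * indicator {d..<p} t + F t * indicator {p..<p + d} t \<partial>lborel)"
    using d by (auto intro!: nn_integral_cong split: split_indicator)
  also have "\<dots> = (\<integral>\<^sup>+ t. F t * indicator {d..<p} t \<partial>lborel) + (\<integral>\<^sup>+ t. F t * indicator {p..<p + d} t \<partial>lborel)"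
    by (rule nn_integral_add) auto
  also have "(\<integral>\<^sup>+ t. F t * indicator {p..<p + d} t \<partial>lborel) = (\<integral>\<^sup>+ t. F t * indicator {0..<d} t \<partial>lborel)"
    by (subst shift[of _ p]) (auto intro!: nn_integral_cong simp: per split: split_indicator)
  also have "(\<integral>\<^sup>+ t. F t * indicator {d..<p} t \<partial>lborel) + \<dots>
      = (\<integral>\<^sup>+ t. F t * indicator {d..<p} t + F t * indicator {0..<d} t \<partial>lborel)"
    by (rule nn_integral_add[symmetric]) auto
  also have "\<dots> = (\<integral>\<^sup>+ t. F t * indicator {0..<p} t \<partial>lborel)"
    using d by (auto intro!: nn_integral_cong split: split_indicator)
  finally show ?thesis by (simp add: Fc)
qed

text \<open>No angle coordinate is chosen, so the centre is unproblematic: it is fixed whatever the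
  value \<open>w 0\<close>.\<close>

definition twist :: "real^2 \<Rightarrow> (real \<Rightarrow> real) \<Rightarrow> real^2 \<Rightarrow> real^2" where
  "twist q w u = q + rot (w (norm (u - q))) (u - q)"

lemma norm_twist [simp]: "norm (twist q w u - q) = norm (u - q)"
  by (simp add: twist_def)

lemma twist_twist: "twist q w (twist q w' u) = twist q (\<lambda>r. w r + w' r) u"
  by (simp add: twist_def rot_rot)

lemma twist_fixed: "w (norm (u - q)) = 0 \<Longrightarrow> twist q w u = u"
  by (simp add: twist_def)

lemma continuous_on_twist:
  assumes "continuous_on UNIV w"
  shows "continuous_on S (twist q w)"
proof -
  have "continuous_on S (\<lambda>u. w (norm (u - q)))"
    by (rule continuous_on_compose2[OF assms]) (auto intro!: continuous_intros)
  then show ?thesis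
    unfolding twist_def by (intro continuous_intros)
qed

text \<open>A twist commutes with the rotations about its centre and agrees with one of them on each
  circle, so averaging over the rotations turns it into a shift of the angle.\<close>

lemma twist_centred_preserves_lborel:
  assumes w: "continuous_on UNIV w" and [measurable]: "B \<in> sets borel"
  shows "emeasure lborel (twist 0 w -` B) = emeasure lborel B"
proof -
  let ?T = "twist 0 w"
  let ?I = "indicator {0..<2 * pi} :: real \<Rightarrow> ennreal"
  have [measurable]: "?T \<in> borel_measurable borel"
    by (intro borel_measurable_continuous_onI continuous_on_twist w)
  \<comment> \<open>All rotated copies of \<open>A\<close> have the same measure. Integrating this
    over a full turn and exchanging the integrals expresses the measure through the angular size of
    \<open>A\<close> on each circle.\<close>
  have average: "ennreal (2 * pi) * emeasure lborel A
      = (\<integral>\<^sup>+ u. (\<integral>\<^sup>+ t. indicator A (rot t u) * ?I t \<partial>lborel) \<partial>lborel)"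
    if [measurable]: "A \<in> sets borel" for A
  proof -
    have "emeasure lborel A = (\<integral>\<^sup>+ u. indicator A (rot t u) \<partial>lborel)" for t
    proof -
      have "emeasure lborel A = (\<integral>\<^sup>+ u. indicator A u \<partial>distr lborel borel (rot t))"
        by (simp add: distr_lborel_rot)
      also have "\<dots> = (\<integral>\<^sup>+ u. indicator A (rot t u) \<partial>lborel)"
        by (rule nn_integral_distr) measurable
      finally show ?thesis .
    qed
    then have "(\<integral>\<^sup>+ t. emeasure lborel A * ?I t \<partial>lborel)
        = (\<integral>\<^sup>+ t. (\<integral>\<^sup>+ u. indicator A (rot t u) * ?I t \<partial>lborel) \<partial>lborel)"
      by (intro nn_integral_cong) (auto simp: nn_integral_multc)
    also have "\<dots> = (\<integral>\<^sup>+ u. (\<integral>\<^sup>+ t. indicator A (rot t u) * ?I t \<partial>lborel) \<partial>lborel)"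
      by (rule lborel_pair.Fubini'[symmetric]) measurable
    finally show ?thesis
      by (simp add: nn_integral_cmult_indicator mult.commute)
  qed
  have rot_T: "?T (rot t u) = rot (t + w (norm u)) u" for t u
    by (simp add: twist_def rot_rot add.commute)
  have "ennreal (2 * pi) * emeasure lborel (?T -` B)
      = (\<integral>\<^sup>+ u. (\<integral>\<^sup>+ t. indicator (?T -` B) (rot t u) * ?I t \<partial>lborel) \<partial>lborel)"
    using measurable_sets_borel[of ?T borel B] by (intro average) simp
  also have "\<dots> = (\<integral>\<^sup>+ u. (\<integral>\<^sup>+ t. indicator B (rot (t + w (norm u)) u) * ?I t \<partial>lborel) \<partial>lborel)"
    by (simp add: indicator_def rot_T)
  also have "\<dots> = (\<integral>\<^sup>+ u. (\<integral>\<^sup>+ t. indicator B (rot t u) * ?I t \<partial>lborel) \<partial>lborel)"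
    by (intro nn_integral_cong nn_integral_periodic_shift[where F = "\<lambda>t. indicator B (rot t _)"]) auto
  also have "\<dots> = ennreal (2 * pi) * emeasure lborel B"
    by (rule average[symmetric]) simp
  finally show ?thesis
    by (simp add: ennreal_mult_cancel_left)
qed

lemma twist_preserves_lborel:
  assumes w: "continuous_on UNIV w" and [measurable]: "B \<in> sets borel"
  shows "emeasure lborel (twist q w -` B) = emeasure lborel B"
proof -
  have [measurable]: "twist q w \<in> borel_measurable borel" for q
    by (intro borel_measurable_continuous_onI continuous_on_twist w)
  have translate: "emeasure lborel A = emeasure lborel ((+) q -` A)" if [measurable]: "A \<in> sets borel" for A
    by (subst lborel_distr_plus[of q, symmetric], subst emeasure_distr) auto
  have "emeasure lborel (twist q w -` B) = emeasure lborel ((+) q -` (twist q w -` B))"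
    using measurable_sets_borel[of "twist q w" borel B] by (intro translate) simp
  also have "(+) q -` (twist q w -` B) = twist 0 w -` ((+) q -` B)"
    by (auto simp: twist_def)
  also have "emeasure lborel \<dots> = emeasure lborel ((+) q -` B)"
    by (rule twist_centred_preserves_lborel[OF w]) (rule measurable_sets_borel[of _ borel], auto)
  also have "\<dots> = emeasure lborel B"
    by (rule translate[symmetric]) simp
  finally show ?thesis .
qed

text \<open>The Taylor remainder is at most \<open>\<bar>x\<bar> ^ 3 / 6\<close>, which is below
  half of \<open>\<bar>x\<bar>\<close>.\<close>

lemma abs_sin_ge_half: "\<bar>x\<bar> \<le> 1 \<Longrightarrow> \<bar>x\<bar> / 2 \<le> \<bar>sin x\<bar>" for x :: real
proof -
  assume x: "\<bar>x\<bar> \<le> 1"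
  have "(\<Sum>m<3. sin_coeff m * x ^ m) = x"
    by (simp add: sin_coeff_def numeral_eq_Suc)
  then have "\<bar>sin x - x\<bar> \<le> inverse (fact 3) * \<bar>x\<bar> ^ 3"
    using Maclaurin_sin_bound[of x 3] by simp
  also have "\<dots> \<le> inverse (fact 3) * \<bar>x\<bar>"
    using x power_decreasing[of 1 3 "\<bar>x\<bar>"] by (intro mult_left_mono) auto
  also have "\<dots> \<le> \<bar>x\<bar> / 2" by (simp add: fact_numeral)
  finally show ?thesis by linarith
qed

text \<open>Up to a rotation the difference is \<open>rot (s - t) z - z\<close>, whose component in
  the tangential direction \<open>quarter z\<close> has length
  \<open>\<bar>sin (s - t)\<bar> * norm z\<close>.\<close>

lemma norm_rot_diff_ge: "\<bar>sin (s - t)\<bar> * norm z \<le> norm (rot s z - rot t z)"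
proof -
  have quarter: "quarter z = rot (pi / 2) z" by (simp add: rot_def)
  have "(rot (s - t) z - z) \<bullet> quarter z = sin (s - t) * (norm z)\<^sup>2"
    by (simp add: quarter_def inner_vec_def sum_2 power2_norm_eq_inner) algebra
  then have "\<bar>sin (s - t)\<bar> * norm z * norm z \<le> norm (rot (s - t) z - z) * norm z"
    using Cauchy_Schwarz_ineq2[of "rot (s - t) z - z" "quarter z"]
    by (simp add: quarter abs_mult power2_eq_square mult.assoc)
  then have "\<bar>sin (s - t)\<bar> * norm z \<le> norm (rot (s - t) z - z)"
    by (cases "z = 0") auto
  also have "rot (s - t) z - z = rot (- t) (rot s z - rot t z)"
    by (simp add: linear_diff[OF linear_rot] rot_rot)
  finally show ?thesis by simp
qed

text \<open>The witness is \<open>u\<close> moved along its own ray to a radius \<open>s\<close>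
  where \<open>w\<close> changes steeply. The images then differ by an angle of
  \<open>n * (w s - w r)\<close> at radius \<open>r\<close>, up to a radial error of length
  \<open>\<bar>s - r\<bar>\<close>.\<close>

lemma twist_not_Lipschitz:
  assumes w: "continuous_on UNIV w" and u: "u \<noteq> q"
    and steep: "\<And>K e. e > 0 \<Longrightarrow> \<exists>s. \<bar>s - norm (u - q)\<bar> < e
      \<and> K * \<bar>s - norm (u - q)\<bar> < \<bar>w s - w (norm (u - q))\<bar>"
    and n: "n \<ge> 1" and e: "e > 0"
  shows "\<exists>v. dist v u < e
    \<and> K * norm (u - v) < norm (twist q (\<lambda>r. n * w r) u - twist q (\<lambda>r. n * w r) v)"
proof -
  define z where "z = u - q"
  define r where "r = norm z"
  have r: "r > 0" using u by (simp add: r_def z_def)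
  \<comment> \<open>Continuity keeps the angle difference below 1, where the sine is comparable to
    its argument; a larger angle could be close to a full turn.\<close>
  have "isCont (\<lambda>s. n * w s) r"
    using w by (intro continuous_intros) (simp add: continuous_on_eq_continuous_at)
  then obtain e1 where e1: "e1 > 0" "\<And>s. \<bar>s - r\<bar> < e1 \<Longrightarrow> \<bar>n * w s - n * w r\<bar> < 1"
    unfolding continuous_at_eps_delta dist_real_def by (metis zero_less_one)
  \<comment> \<open>An angle yields a displacement with factor \<open>r / 2\<close>, which
    \<open>2 / r\<close> compensates. Of the summand 2, one unit pays for the radial error and one
    is slack. The bound \<open>r\<close> keeps \<open>s\<close> positive.\<close>
  obtain s where s: "\<bar>s - r\<bar> < min e (min e1 r)" "2 * (\<bar>K\<bar> + 2) / r * \<bar>s - r\<bar> < \<bar>w s - w r\<bar>"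
    using steep[of "min e (min e1 r)" "2 * (\<bar>K\<bar> + 2) / r"] e e1 r by (auto simp: r_def z_def)
  then have "s > 0" by linarith
  define v where "v = q + (s / r) *\<^sub>R z"
  have vq: "norm (v - q) = s"
    using r \<open>s > 0\<close> by (simp add: v_def r_def)
  have vu: "v - u = ((s - r) / r) *\<^sub>R z"
    using r by (simp add: v_def z_def diff_divide_distrib scaleR_diff_left)
  then have dist_vu: "norm (v - u) = \<bar>s - r\<bar>"
    using r by (simp add: r_def)
  let ?T = "twist q (\<lambda>r. n * w r)"
  have "?T v - ?T u = rot (n * w s) (v - q) - rot (n * w r) z"
    by (simp add: twist_def vq r_def z_def)
  also have "v - q = z + (v - u)" by (simp add: z_def)
  finally have Tdiff: "?T v - ?T u = (rot (n * w s) z - rot (n * w r) z) + rot (n * w s) (v - u)"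
    by (simp add: linear_add[OF linear_rot])
  have "\<bar>K\<bar> * \<bar>s - r\<bar> + 2 * \<bar>s - r\<bar> < \<bar>w s - w r\<bar> / 2 * r"
    using s(2) r by (simp add: field_simps)
  also have "\<dots> \<le> n * \<bar>w s - w r\<bar> / 2 * r"
    using n r mult_right_mono[of 1 n "\<bar>w s - w r\<bar>"] by (intro mult_right_mono) auto
  also have "n * \<bar>w s - w r\<bar> = \<bar>n * w s - n * w r\<bar>"
    using n by (simp add: abs_mult flip: right_diff_distrib)
  also have "\<dots> / 2 * r \<le> \<bar>sin (n * w s - n * w r)\<bar> * r"
    using e1(2)[of s] s(1) r by (intro mult_right_mono abs_sin_ge_half) auto
  also have "\<dots> \<le> norm (rot (n * w s) z - rot (n * w r) z)"
    unfolding r_def by (rule norm_rot_diff_ge)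
  also have "\<dots> \<le> norm (?T v - ?T u) + \<bar>s - r\<bar>"
    using norm_triangle_ineq4[of "?T v - ?T u" "rot (n * w s) (v - u)"] dist_vu by (simp add: Tdiff)
  finally have "\<bar>K\<bar> * \<bar>s - r\<bar> + 2 * \<bar>s - r\<bar> < norm (?T v - ?T u) + \<bar>s - r\<bar>" .
  then have "\<bar>K\<bar> * \<bar>s - r\<bar> + \<bar>s - r\<bar> < norm (?T v - ?T u)"
    by (simp only: mult_2 add.assoc[symmetric] add_less_cancel_right)
  moreover have "K * \<bar>s - r\<bar> \<le> \<bar>K\<bar> * \<bar>s - r\<bar>" by (intro mult_right_mono) auto
  ultimately have "K * norm (u - v) < norm (?T u - ?T v)"
    using dist_vu by (simp add: norm_minus_commute)
  then show ?thesis
    using s(1) dist_vu by (intro exI[of _ v]) (simp add: dist_norm)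
qed

section \<open>The Riemannian distance\<close>

text \<open>The speed of a curve need not be a measurable function, so its integral is manipulated through
  the following facts, which do not assume measurability.\<close>

lemma nn_integral_real_affine_le:
  fixes f :: "real \<Rightarrow> ennreal"
  assumes "m \<noteq> 0"
  shows "(\<integral>\<^sup>+ t. ennreal \<bar>m\<bar> * f (m * t + k) \<partial>lborel) \<le> (\<integral>\<^sup>+ t. f t \<partial>lborel)"
  \<comment> \<open>The integral is a supremum over simple minorants, which are measurable whatever
    \<open>f\<close> is. The change of variables is applied to these.\<close>
  unfolding nn_integral_def[of lborel "\<lambda>t. ennreal \<bar>m\<bar> * f (m * t + k)"]
proof (rule SUP_least, safe)
  fix g :: "real \<Rightarrow> ennreal"
  assume g: "simple_function lborel g" and le: "g \<le> (\<lambda>t. ennreal \<bar>m\<bar> * f (m * t + k))"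
  have [measurable]: "g \<in> borel_measurable borel"
    using borel_measurable_simple_function[OF g] by simp
  have "integral\<^sup>S lborel g = (\<integral>\<^sup>+ t. g t \<partial>lborel)"
    by (rule nn_integral_eq_simple_integral[OF g, symmetric])
  also have "\<dots> = ennreal \<bar>1 / m\<bar> * (\<integral>\<^sup>+ t. g (- k / m + 1 / m * t) \<partial>lborel)"
    using assms by (intro nn_integral_real_affine) auto
  also have "\<dots> = (\<integral>\<^sup>+ t. ennreal \<bar>1 / m\<bar> * g (- k / m + 1 / m * t) \<partial>lborel)"
    by (rule nn_integral_cmult[symmetric]) simp
  also have "\<dots> \<le> (\<integral>\<^sup>+ t. f t \<partial>lborel)"
  proof (rule nn_integral_mono)
    fix t
    have "g (- k / m + 1 / m * t) \<le> ennreal \<bar>m\<bar> * f (m * (- k / m + 1 / m * t) + k)"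
      using le by (simp add: le_fun_def)
    also have "m * (- k / m + 1 / m * t) + k = t"
      using assms by (simp add: field_simps)
    finally have "ennreal \<bar>1 / m\<bar> * g (- k / m + 1 / m * t) \<le> ennreal \<bar>1 / m\<bar> * (ennreal \<bar>m\<bar> * f t)"
      by (rule mult_left_mono) simp
    also have "\<dots> = f t"
      using assms by (simp add: mult.assoc[symmetric] ennreal_mult[symmetric])
    finally show "ennreal \<bar>1 / m\<bar> * g (- k / m + 1 / m * t) \<le> f t" .
  qed
  finally show "integral\<^sup>S lborel g \<le> (\<integral>\<^sup>+ t. f t \<partial>lborel)" .
qed

text \<open>A simple minorant of \<open>f\<close> splits additively along \<open>A\<close>, and its
  two parts are minorants of the two parts of \<open>f\<close>.\<close>

lemma nn_integral_le_split:
  assumes [measurable]: "A \<in> sets M"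
  shows "(\<integral>\<^sup>+ x. f x \<partial>M) \<le> (\<integral>\<^sup>+ x. f x * indicator A x \<partial>M) + (\<integral>\<^sup>+ x. f x * indicator (- A) x \<partial>M)"
  unfolding nn_integral_def[of M f]
proof (rule SUP_least, safe)
  fix g assume g: "simple_function M g" and le: "g \<le> f"
  have [measurable]: "g \<in> borel_measurable M"
    using borel_measurable_simple_function[OF g] by simp
  have "integral\<^sup>S M g = (\<integral>\<^sup>+ x. g x * indicator A x + g x * indicator (- A) x \<partial>M)"
    unfolding nn_integral_eq_simple_integral[OF g, symmetric]
    by (intro nn_integral_cong) (auto split: split_indicator)
  also have "\<dots> = (\<integral>\<^sup>+ x. g x * indicator A x \<partial>M) + (\<integral>\<^sup>+ x. g x * indicator (- A) x \<partial>M)"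
    by (rule nn_integral_add) (auto intro!: borel_measurable_times_ennreal borel_measurable_indicator')
  also have "\<dots> \<le> (\<integral>\<^sup>+ x. f x * indicator A x \<partial>M) + (\<integral>\<^sup>+ x. f x * indicator (- A) x \<partial>M)"
    using le by (intro add_mono nn_integral_mono mult_right_mono) (auto simp: le_fun_def)
  finally show "integral\<^sup>S M g \<le> \<dots>" .
qed

text \<open>The derivatives involved are two-sided while \<open>f\<close> and \<open>g\<close> agree
  only on the interval, so both endpoints join the finite exceptional set.\<close>

lemma piecewise_C1_differentiable_on_cong:
  assumes f: "f piecewise_C1_differentiable_on {a..b}" and eq: "\<And>t. t \<in> {a..b} \<Longrightarrow> f t = g t"
  shows "g piecewise_C1_differentiable_on {a..b}"
proof -
  obtain S D where S: "finite S" "\<And>t. t \<in> {a..b} - S \<Longrightarrow> (f has_vector_derivative D t) (at t)"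
    "continuous_on ({a..b} - S) D"
    using f unfolding piecewise_C1_differentiable_on_def C1_differentiable_on_def by blast
  have "(g has_vector_derivative D t) (at t)" if "t \<in> {a..b} - (insert a (insert b S))" for t
    by (rule has_vector_derivative_transform_within_open[where S = "{a<..<b}" and f = f])
      (use that S eq in auto)
  moreover have "continuous_on ({a..b} - (insert a (insert b S))) D"
    by (rule continuous_on_subset[OF S(3)]) auto
  moreover have "continuous_on {a..b} g"
    using f eq continuous_on_cong[of "{a..b}" "{a..b}" f g]
    unfolding piecewise_C1_differentiable_on_def by auto
  ultimately show ?thesis
    unfolding piecewise_C1_differentiable_on_def C1_differentiable_on_def
    using S(1) by (meson finite.insertI)
qed

lemma piecewise_C1_differentiable_on_affine:
  fixes m :: real
  assumes "f piecewise_C1_differentiable_on (\<lambda>t. m * t + k) ` {a..b}" "m \<noteq> 0"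
  shows "(\<lambda>t. f (m * t + k)) piecewise_C1_differentiable_on {a..b}"
proof -
  have "f \<circ> (\<lambda>t. m * t + k) piecewise_C1_differentiable_on {a..b}"
  proof (rule piecewise_C1_differentiable_compose)
    show "(\<lambda>t. m * t + k) piecewise_C1_differentiable_on {a..b}"
      by (intro C1_differentiable_imp_piecewise) simp
    show "finite ({a..b} \<inter> (\<lambda>t. m * t + k) -` {x})" for x
      by (rule finite_subset[of _ "{(x - k) / m}"]) (use assms(2) in \<open>auto simp: field_simps\<close>)
  qed (use assms(1) in simp)
  then show ?thesis by (simp add: o_def)
qed

lemma image_affine_Icc_pos: "(m::real) > 0 \<Longrightarrow> (\<lambda>t. m * t + k) ` {a..b} = {m * a + k..m * b + k}"
  by (auto simp: image_affinity_atLeastAtMost)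

section \<open>Piecewise C1 curves: restriction to a chart, reversal, concatenation\<close>

lemma piecewise_C1_curveD:
  assumes "piecewise_C1_curve \<A> \<gamma>" "c \<in> \<A>" "0 \<le> a" "b \<le> 1" "\<And>t. t \<in> {a..b} \<Longrightarrow> \<gamma> t \<in> fst c"
  shows "(snd c \<circ> \<gamma>) piecewise_C1_differentiable_on {a..b}"
  using assms unfolding piecewise_C1_curve_def by blast

lemma piecewise_C1_curve_reverse:
  assumes "piecewise_C1_curve \<A> \<gamma>"
  shows "piecewise_C1_curve \<A> (\<lambda>t. \<gamma> (1 - t))"
  unfolding piecewise_C1_curve_def
proof (intro conjI ballI allI impI)
  show "continuous_on {0..1} (\<lambda>t. \<gamma> (1 - t))"
    by (rule continuous_on_compose2[of "{0..1}" \<gamma>])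
      (use assms in \<open>auto simp: piecewise_C1_curve_def intro!: continuous_intros\<close>)
  fix c and a b :: real
  assume c: "c \<in> \<A>" and ab: "0 \<le> a \<and> b \<le> 1 \<and> (\<lambda>t. \<gamma> (1 - t)) ` {a..b} \<subseteq> fst c"
  have im: "(\<lambda>t. -1 * t + 1) ` {a..b} = {1 - b..1 - a}"
    by (auto simp: image_iff intro!: bexI[of _ "1 - _"])
  have "\<gamma> r \<in> fst c" if "r \<in> {1 - b..1 - a}" for r
    using ab that by (auto simp: image_subset_iff dest: bspec[of _ _ "1 - r"])
  then have "(snd c \<circ> \<gamma>) piecewise_C1_differentiable_on {1 - b..1 - a}"
    using ab by (intro piecewise_C1_curveD[OF assms c]) auto
  from piecewise_C1_differentiable_on_affine[OF this[folded im]]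
  show "(snd c \<circ> (\<lambda>t. \<gamma> (1 - t))) piecewise_C1_differentiable_on {a..b}"
    by (simp add: o_def)
qed

text \<open>The triangle inequality rests on this closure property. A parameter interval mapped into
  one chart lies in the first half, lies in the second, or contains \<open>1/2\<close>, where a
  corner is allowed.\<close>

lemma piecewise_C1_curve_join:
  assumes s: "piecewise_C1_curve \<A> \<sigma>" and t: "piecewise_C1_curve \<A> \<tau>" and st: "\<sigma> 1 = \<tau> 0"
  shows "piecewise_C1_curve \<A> (\<sigma> +++ \<tau>)"
  unfolding piecewise_C1_curve_def
proof (intro conjI ballI allI impI)
  show "continuous_on {0..1} (\<sigma> +++ \<tau>)"
    by (rule continuous_on_joinpaths)
      (use assms in \<open>auto simp: piecewise_C1_curve_def pathstart_def pathfinish_def\<close>)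
  fix c and a b :: real
  assume c: "c \<in> \<A>" and ab: "0 \<le> a \<and> b \<le> 1 \<and> (\<sigma> +++ \<tau>) ` {a..b} \<subseteq> fst c"
  let ?f = "snd c \<circ> (\<sigma> +++ \<tau>)"
  have left: "(\<lambda>t. (snd c \<circ> \<sigma>) (2 * t + 0)) piecewise_C1_differentiable_on {a'..b'}"
    if "a \<le> a'" "b' \<le> b" "b' \<le> 1/2" for a' b'
  proof (rule piecewise_C1_differentiable_on_affine)
    have "\<sigma> r \<in> fst c" if "r \<in> {2 * a'..2 * b'}" for r
    proof -
      have "(\<sigma> +++ \<tau>) (r / 2) \<in> fst c"
        using ab that \<open>a \<le> a'\<close> \<open>b' \<le> b\<close> by auto
      then show ?thesis using that \<open>b' \<le> 1/2\<close> by (simp add: joinpaths_def)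
    qed
    then show "(snd c \<circ> \<sigma>) piecewise_C1_differentiable_on (\<lambda>t. 2 * t + 0) ` {a'..b'}"
      using that ab by (subst image_affine_Icc_pos) (auto intro!: piecewise_C1_curveD[OF s c])
  qed simp
  have right: "(\<lambda>t. (snd c \<circ> \<tau>) (2 * t + - 1)) piecewise_C1_differentiable_on {a'..b'}"
    if "a \<le> a'" "b' \<le> b" "1/2 \<le> a'" for a' b'
  proof (rule piecewise_C1_differentiable_on_affine)
    have "\<tau> r \<in> fst c" if "r \<in> {2 * a' - 1..2 * b' - 1}" for r
    proof -
      have "(\<sigma> +++ \<tau>) ((r + 1) / 2) \<in> fst c"
        using ab that \<open>a \<le> a'\<close> \<open>b' \<le> b\<close> by auto
      moreover have "(\<sigma> +++ \<tau>) ((r + 1) / 2) = \<tau> r"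
        using that \<open>1/2 \<le> a'\<close> st by (cases "r = 0") (auto simp: joinpaths_def add_divide_distrib)
      ultimately show ?thesis by simp
    qed
    then show "(snd c \<circ> \<tau>) piecewise_C1_differentiable_on (\<lambda>t. 2 * t + - 1) ` {a'..b'}"
      using that ab by (subst image_affine_Icc_pos) (auto intro!: piecewise_C1_curveD[OF t c])
  qed simp
  consider "b \<le> 1/2" | "1/2 \<le> a" | "a \<le> 1/2" "1/2 \<le> b" by linarith
  then show "?f piecewise_C1_differentiable_on {a..b}"
  proof cases
    case 1
    show ?thesis
      by (rule piecewise_C1_differentiable_on_cong[OF left[OF order_refl order_refl 1]])
        (use 1 in \<open>auto simp: joinpaths_def\<close>)
  next
    case 2
    \<comment> \<open>At \<open>1/2\<close> the concatenation takes its first branch, with value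
      \<open>\<sigma> 1\<close>, which is \<open>\<tau> 0\<close> by assumption.\<close>
    have "(snd c \<circ> \<tau>) (2 * t + - 1) = ?f t" if "t \<in> {a..b}" for t
    proof (cases "t = 1/2")
      case True
      show ?thesis unfolding True using st by (simp add: joinpaths_def)
    qed (use 2 that in \<open>auto simp: joinpaths_def\<close>)
    then show ?thesis
      by (rule piecewise_C1_differentiable_on_cong[OF right[OF order_refl order_refl 2]])
  next
    case 3
    have "(\<lambda>t. if t \<le> 1/2 then (snd c \<circ> \<sigma>) (2 * t + 0) else (snd c \<circ> \<tau>) (2 * t + - 1))
        piecewise_C1_differentiable_on {a..b}"
      using 3 st by (intro piecewise_C1_differentiable_cases left right) auto
    then show ?thesis
      by (rule piecewise_C1_differentiable_on_cong) (auto simp: joinpaths_def)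
  qed
qed

section \<open>Velocities under composition and affine reparametrisation\<close>

lemma has_vector_derivative_chain:
  assumes "(\<gamma> has_vector_derivative v) (at t)" "(f has_derivative D) (at (\<gamma> t))"
  shows "(f \<circ> \<gamma> has_vector_derivative D v) (at t)"
  using vector_derivative_diff_chain_within[of \<gamma> v t UNIV f D] assms
  by (auto intro: has_derivative_at_withinI)

text \<open>An equivalence, so that non-differentiability transfers as well. The converse is the
  chain rule with the inverse affine map.\<close>

lemma has_vector_derivative_affine_iff:
  fixes f :: "real \<Rightarrow> 'b::real_normed_vector"
  assumes "m \<noteq> 0"
  shows "((\<lambda>s. f (m * s + k)) has_vector_derivative m *\<^sub>R v) (at t)
    \<longleftrightarrow> (f has_vector_derivative v) (at (m * t + k))"
proof
  have aff: "((\<lambda>s. a * s + b) has_vector_derivative a) (at t)" for a b t :: real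
    by (auto intro!: derivative_eq_intros simp: has_real_derivative_iff_has_vector_derivative[symmetric])
  show "((\<lambda>s. f (m * s + k)) has_vector_derivative m *\<^sub>R v) (at t)"
    if "(f has_vector_derivative v) (at (m * t + k))"
    using vector_diff_chain_at[OF aff that] by (simp add: o_def)
  assume "((\<lambda>s. f (m * s + k)) has_vector_derivative m *\<^sub>R v) (at t)"
  moreover have "1 / m * (m * t + k) + (- k / m) = t"
    using assms by (simp add: field_simps)
  ultimately have "((\<lambda>s. f (m * s + k)) has_vector_derivative m *\<^sub>R v) (at (1 / m * (m * t + k) + (- k / m)))"
    by simp
  from vector_diff_chain_at[OF aff this]
  show "(f has_vector_derivative v) (at (m * t + k))"
    using assms by (simp add: o_def algebra_simps)
qed

text \<open>Where \<open>f\<close> is not differentiable, both derivatives are the same junk vector.\<close>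

lemma vector_derivative_affine_cases:
  fixes f :: "real \<Rightarrow> 'b::real_normed_vector"
  assumes "m \<noteq> 0" "\<forall>\<^sub>F s in nhds t. g s = f (m * s + k)"
  shows "vector_derivative g (at t) = m *\<^sub>R vector_derivative f (at (m * t + k))
    \<or> vector_derivative g (at t) = vector_derivative f (at (m * t + k))"
proof -
  let ?h = "\<lambda>s. f (m * s + k)"
  have g: "vector_derivative g (at t) = vector_derivative ?h (at t)"
    using assms(2) by (intro vector_derivative_cong_eq) auto
  show ?thesis
  proof (cases "\<exists>v. (f has_vector_derivative v) (at (m * t + k))")
    case True
    then obtain v where v: "(f has_vector_derivative v) (at (m * t + k))" by blast
    then have "(?h has_vector_derivative m *\<^sub>R v) (at t)"
      using has_vector_derivative_affine_iff[OF assms(1)] by blast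
    with v show ?thesis by (simp add: g vector_derivative_at)
  next
    case False
    then have "\<not> (?h has_vector_derivative v) (at t)" for v
      using has_vector_derivative_affine_iff[OF assms(1), of f k "(1 / m) *\<^sub>R v" t] assms(1) by auto
    with False have "vector_derivative ?h (at t) = vector_derivative f (at (m * t + k))"
      unfolding vector_derivative_def by simp
    with g show ?thesis by simp
  qed
qed

section \<open>Charts as homeomorphisms between open sets\<close>

context
  fixes c :: "'a::topological_space chart"
  assumes c: "is_chart c"
begin

lemma chart_open: "open (fst c)" and chart_image_open: "open (snd c ` fst c)"
  using c by (auto simp: is_chart_def)

lemma chart_inj: "inj_on (snd c) (fst c)"
  using c unfolding is_chart_def homeomorphism_def by (metis inj_on_inverseI)

lemma chart_inv: "x \<in> fst c \<Longrightarrow> inv_into (fst c) (snd c) (snd c x) = x"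
  using chart_inj by simp

lemma chart_continuous: "continuous_on (fst c) (snd c)"
  and chart_inv_continuous: "continuous_on (snd c ` fst c) (inv_into (fst c) (snd c))"
  using c by (auto simp: is_chart_def homeomorphism_def)

lemma chart_open_map:
  assumes "open V" "V \<subseteq> fst c"
  shows "open (snd c ` V)"
proof -
  have "snd c ` V = snd c ` fst c \<inter> inv_into (fst c) (snd c) -` V"
    using assms(2) chart_inv by force
  then show ?thesis
    using continuous_on_open_vimage[OF chart_image_open] chart_inv_continuous assms(1)
    by (metis inf_commute)
qed

lemma chart_inv_open_map:
  assumes "open V" "V \<subseteq> snd c ` fst c"
  shows "open (inv_into (fst c) (snd c) ` V)"
proof -
  have "inv_into (fst c) (snd c) ` V = fst c \<inter> snd c -` V"
    using assms(2) chart_inv by (force simp: image_iff)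
  then show ?thesis
    using continuous_on_open_vimage[OF chart_open] chart_continuous assms(1)
    by (metis inf_commute)
qed

end

lemma smooth_on_openD:
  assumes "open W" "smooth_on f W"
  shows "u \<in> W \<Longrightarrow> (f has_derivative frechet_derivative f (at u)) (at u)"
    and "continuous_on W (\<lambda>u. frechet_derivative f (at u) v)"
    and "continuous_on W f"
proof -
  have "ck_on (Suc 0) f W" "ck_on 0 f W"
    using assms(2) unfolding smooth_on_def by blast+
  then show "continuous_on W (\<lambda>u. frechet_derivative f (at u) v)" "continuous_on W f"
    and "u \<in> W \<Longrightarrow> (f has_derivative frechet_derivative f (at u)) (at u)"
    using assms(1) by (auto simp: differentiable_on_eq_differentiable_at frechet_derivative_works)
qed

section \<open>Speed and length of curves in a Riemannian atlas\<close>

locale riemannian_atlas =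
  fixes \<A> :: "'a::t2_space chart set" and G :: "'a chart \<Rightarrow> real^2 \<Rightarrow> real^2^2"
  assumes atlas: "smooth_atlas \<A>" and metric: "riemannian_metric \<A> G"
begin

lemma atlas_chart: "c \<in> \<A> \<Longrightarrow> is_chart c"
  and atlas_compatible: "c \<in> \<A> \<Longrightarrow> c' \<in> \<A> \<Longrightarrow> compatible c c'"
  and atlas_smooth_chart: "c \<in> \<A> \<Longrightarrow> smooth_chart \<A> c"
  using atlas unfolding smooth_atlas_def smooth_chart_def by blast+

lemma atlas_cover: obtains c where "c \<in> \<A>" "x \<in> fst c"
  using atlas unfolding smooth_atlas_def by blast

lemma form_pos: "c \<in> \<A> \<Longrightarrow> u \<in> snd c ` fst c \<Longrightarrow> v \<noteq> 0 \<Longrightarrow> v \<bullet> (G c u *v v) > 0"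
  using metric unfolding riemannian_metric_def by blast

lemma form_nonneg: "c \<in> \<A> \<Longrightarrow> u \<in> snd c ` fst c \<Longrightarrow> v \<bullet> (G c u *v v) \<ge> 0"
  using form_pos[of c u v] by (cases "v = 0") (auto intro: less_imp_le)

lemma form_continuous: "c \<in> \<A> \<Longrightarrow> continuous_on (snd c ` fst c) (G c)"
  using metric smooth_on_openD(3)[OF chart_image_open[OF atlas_chart]]
  unfolding riemannian_metric_def by blast

lemma form_transform:
  assumes "c \<in> \<A>" "c' \<in> \<A>" "x \<in> fst c" "x \<in> fst c'"
  shows "v \<bullet> (G c (snd c x) *v v)
    = frechet_derivative (transition c c') (at (snd c x)) v
      \<bullet> (G c' (snd c' x) *v frechet_derivative (transition c c') (at (snd c x)) v)"
  using metric assms unfolding riemannian_metric_def Let_def by blast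

lemma transition_derivative:
  assumes "is_chart c" "is_chart c'" "compatible c c'"
  shows "x \<in> fst c \<Longrightarrow> x \<in> fst c' \<Longrightarrow> (transition c c' has_derivative
      frechet_derivative (transition c c') (at (snd c x))) (at (snd c x))"
    and "continuous_on (snd c ` (fst c \<inter> fst c')) (\<lambda>u. frechet_derivative (transition c c') (at u) v)"
    and "continuous_on (snd c ` (fst c \<inter> fst c')) (transition c c')"
proof -
  have "open (snd c ` (fst c \<inter> fst c'))"
    using assms by (intro chart_open_map open_Int chart_open) auto
  moreover have "smooth_on (transition c c') (snd c ` (fst c \<inter> fst c'))"
    using assms(3) by (simp add: compatible_def)
  ultimately show "x \<in> fst c \<Longrightarrow> x \<in> fst c' \<Longrightarrow> (transition c c' has_derivative
      frechet_derivative (transition c c') (at (snd c x))) (at (snd c x))"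
    and "continuous_on (snd c ` (fst c \<inter> fst c')) (\<lambda>u. frechet_derivative (transition c c') (at u) v)"
    and "continuous_on (snd c ` (fst c \<inter> fst c')) (transition c c')"
    by (simp_all add: smooth_on_openD)
qed

text \<open>\<open>speed\<close> picks a chart by \<open>SOME\<close>. Where the curve is
  differentiable, the chain rule for the transition map and the transformation rule of
  \<open>G\<close> allow any chart of the atlas instead.\<close>

lemma speed_eq:
  assumes c: "c \<in> \<A>" and x: "\<gamma> t \<in> fst c" and \<gamma>: "isCont \<gamma> t"
    and v: "(snd c \<circ> \<gamma> has_vector_derivative v) (at t)"
  shows "speed \<A> G \<gamma> t = sqrt (v \<bullet> (G c (snd c (\<gamma> t)) *v v))"
proof -
  define c' where "c' = (SOME c. c \<in> \<A> \<and> \<gamma> t \<in> fst c)"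
  have c': "c' \<in> \<A>" "\<gamma> t \<in> fst c'"
    unfolding c'_def using someI[of "\<lambda>c. c \<in> \<A> \<and> \<gamma> t \<in> fst c" c] c x by auto
  let ?D = "frechet_derivative (transition c c') (at (snd c (\<gamma> t)))"
  have "\<forall>\<^sub>F s in at t. \<gamma> s \<in> fst c"
    using \<gamma>[unfolded isCont_def] chart_open[OF atlas_chart[OF c]] x by (rule topological_tendstoD)
  then have "\<forall>\<^sub>F s in nhds t. \<gamma> s \<in> fst c"
    unfolding eventually_at_filter by (rule eventually_mono) (use x in auto)
  then have "\<forall>\<^sub>F s in nhds t. s \<in> UNIV \<longrightarrow> (snd c' \<circ> \<gamma>) s = (transition c c' \<circ> (snd c \<circ> \<gamma>)) s"
    by (rule eventually_mono) (simp add: transition_def chart_inv[OF atlas_chart[OF c]])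
  then have "vector_derivative (snd c' \<circ> \<gamma>) (at t)
      = vector_derivative (transition c c' \<circ> (snd c \<circ> \<gamma>)) (at t)"
    by (rule vector_derivative_cong_eq) auto
  also have "\<dots> = ?D v"
    using transition_derivative(1)[OF atlas_chart atlas_chart atlas_compatible, OF c c'(1) c c'(1) x c'(2)]
    by (intro vector_derivative_at has_vector_derivative_chain[OF v]) (simp add: o_def)
  finally show ?thesis
    unfolding speed_def Let_def c'_def[symmetric] using form_transform[OF c c'(1) x c'(2), of v] by simp
qed

text \<open>At points of non-differentiability both velocities are the same default vector and do
  not scale by \<open>m\<close>. The inequality survives there because
  \<open>\<bar>m\<bar> \<ge> 1\<close>.\<close>

lemma speed_affine_le:
  assumes "\<bar>m\<bar> \<ge> 1" "\<forall>\<^sub>F s in nhds t. \<gamma> s = \<sigma> (m * s + k)"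
  shows "speed \<A> G \<gamma> t \<le> \<bar>m\<bar> * speed \<A> G \<sigma> (m * t + k)"
proof -
  have t: "\<gamma> t = \<sigma> (m * t + k)"
    using assms(2) by (rule eventually_nhds_x_imp_x)
  define c where "c = (SOME c. c \<in> \<A> \<and> \<gamma> t \<in> fst c)"
  have c: "c \<in> \<A>" "\<gamma> t \<in> fst c"
    unfolding c_def using someI_ex[of "\<lambda>c. c \<in> \<A> \<and> \<gamma> t \<in> fst c"] atlas_cover by blast+
  define v where "v = vector_derivative (snd c \<circ> \<gamma>) (at t)"
  define v' where "v' = vector_derivative (snd c \<circ> \<sigma>) (at (m * t + k))"
  let ?q = "\<lambda>v. v \<bullet> (G c (snd c (\<gamma> t)) *v v)"
  have "v = m *\<^sub>R v' \<or> v = v'"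
    unfolding v_def v'_def using assms
    by (intro vector_derivative_affine_cases) (auto elim: eventually_mono)
  then have "sqrt (?q v) \<le> \<bar>m\<bar> * sqrt (?q v')"
  proof
    assume "v = m *\<^sub>R v'"
    then have "?q v = m\<^sup>2 * ?q v'"
      by (simp add: power2_eq_square scaleR_matrix_vector_assoc[symmetric] matrix_vector_mult_scaleR)
    then show ?thesis by (simp add: real_sqrt_mult)
  next
    have "0 \<le> ?q v'"
      using c by (intro form_nonneg) auto
    moreover assume "v = v'"
    ultimately show ?thesis using assms(1) by (simp add: mult_le_cancel_right1)
  qed
  then show ?thesis
    unfolding speed_def Let_def c_def[symmetric] t[symmetric] v_def[symmetric] v'_def[symmetric] .
qed

lemma curve_length_reverse: "curve_length \<A> G (\<lambda>t. \<gamma> (1 - t)) \<le> curve_length \<A> G \<gamma>"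
proof -
  let ?s = "\<lambda>t. ennreal (speed \<A> G \<gamma> t) * indicator {0..1} t"
  have "speed \<A> G (\<lambda>t. \<gamma> (1 - t)) t \<le> speed \<A> G \<gamma> (- 1 * t + 1)" for t
    using speed_affine_le[of "-1" "\<lambda>t. \<gamma> (1 - t)" \<gamma> 1 t] by simp
  then have "curve_length \<A> G (\<lambda>t. \<gamma> (1 - t)) \<le> (\<integral>\<^sup>+ t. ennreal \<bar>- 1\<bar> * ?s (- 1 * t + 1) \<partial>lborel)"
    unfolding curve_length_def
    by (intro nn_integral_mono) (auto split: split_indicator intro: ennreal_leI)
  also have "\<dots> \<le> (\<integral>\<^sup>+ t. ?s t \<partial>lborel)"
    by (rule nn_integral_real_affine_le) simp
  finally show ?thesis by (simp add: curve_length_def)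
qed

lemma curve_length_join: "curve_length \<A> G (\<sigma> +++ \<tau>) \<le> curve_length \<A> G \<sigma> + curve_length \<A> G \<tau>"
proof -
  let ?s = "\<lambda>\<gamma> t. ennreal (speed \<A> G \<gamma> t) * indicator {0..1} t"
  let ?g = "\<sigma> +++ \<tau>"
  have l: "speed \<A> G ?g t \<le> 2 * speed \<A> G \<sigma> (2 * t + 0)" if "t < 1/2" for t
  proof -
    have "\<forall>\<^sub>F s in nhds t. s < 1/2"
      using that by (intro eventually_nhds_in_open[of "{..<1/2}", simplified]) auto
    then have "\<forall>\<^sub>F s in nhds t. ?g s = \<sigma> (2 * s + 0)"
      by (rule eventually_mono) (simp add: joinpaths_def)
    then show ?thesis
      using speed_affine_le[of 2 ?g \<sigma> 0 t] by simp
  qed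
  have r: "speed \<A> G ?g t \<le> 2 * speed \<A> G \<tau> (2 * t + - 1)" if "t > 1/2" for t
  proof -
    have "\<forall>\<^sub>F s in nhds t. s > 1/2"
      using that by (intro eventually_nhds_in_open[of "{1/2<..}", simplified]) auto
    then have "\<forall>\<^sub>F s in nhds t. ?g s = \<tau> (2 * s + - 1)"
      by (rule eventually_mono) (simp add: joinpaths_def)
    then show ?thesis
      using speed_affine_le[of 2 ?g \<tau> "-1" t] by simp
  qed
  have "curve_length \<A> G ?g \<le> (\<integral>\<^sup>+ t. ?s ?g t * indicator {..1/2} t \<partial>lborel)
      + (\<integral>\<^sup>+ t. ?s ?g t * indicator (- {..1/2}) t \<partial>lborel)"
    unfolding curve_length_def by (rule nn_integral_le_split) simp
  also have "(\<integral>\<^sup>+ t. ?s ?g t * indicator {..1/2} t \<partial>lborel) \<le> (\<integral>\<^sup>+ t. ennreal \<bar>2\<bar> * ?s \<sigma> (2 * t + 0) \<partial>lborel)"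
  proof (rule nn_integral_mono_AE, rule AE_mp[OF AE_lborel_singleton[of "1/2"]], intro AE_I2 impI)
    \<comment> \<open>At \<open>1/2\<close> the concatenation agrees with neither half on a whole
      neighbourhood, so this null point is left out.\<close>
    fix t :: real assume "t \<noteq> 1/2"
    then show "?s ?g t * indicator {..1/2} t \<le> ennreal \<bar>2\<bar> * ?s \<sigma> (2 * t + 0)"
      using l[of t] by (cases "t < 1/2") (auto split: split_indicator simp: ennreal_mult'[symmetric] simp flip: ennreal_numeral intro: ennreal_leI)
  qed
  also have "\<dots> \<le> curve_length \<A> G \<sigma>"
    unfolding curve_length_def by (rule nn_integral_real_affine_le) simp
  also have "(\<integral>\<^sup>+ t. ?s ?g t * indicator (- {..1/2}) t \<partial>lborel) \<le> (\<integral>\<^sup>+ t. ennreal \<bar>2\<bar> * ?s \<tau> (2 * t + - 1) \<partial>lborel)"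
    using r by (intro nn_integral_mono) (auto split: split_indicator simp: ennreal_mult'[symmetric] simp flip: ennreal_numeral intro: ennreal_leI)
  also have "\<dots> \<le> curve_length \<A> G \<tau>"
    unfolding curve_length_def by (rule nn_integral_real_affine_le) simp
  finally show ?thesis by (simp add: add_mono)
qed

text \<open>The infimum before \<open>enn2real\<close>, which sends \<open>top\<close> to 0. The
  metric laws are proved here, and finiteness is supplied later by connectedness.\<close>

definition edist :: "'a \<Rightarrow> 'a \<Rightarrow> ennreal" where
  "edist x y = (INF \<gamma> \<in> {\<gamma>. piecewise_C1_curve \<A> \<gamma> \<and> \<gamma> 0 = x \<and> \<gamma> 1 = y}. curve_length \<A> G \<gamma>)"

lemma edist_le: "piecewise_C1_curve \<A> \<gamma> \<Longrightarrow> edist (\<gamma> 0) (\<gamma> 1) \<le> curve_length \<A> G \<gamma>"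
  unfolding edist_def by (rule INF_lower) simp

lemma edist_lessE:
  assumes "edist x y < L"
  obtains \<gamma> where "piecewise_C1_curve \<A> \<gamma>" "\<gamma> 0 = x" "\<gamma> 1 = y" "curve_length \<A> G \<gamma> < L"
  using assms unfolding edist_def INF_less_iff by blast

lemma edist_commute: "edist x y = edist y x"
proof -
  have "edist y x \<le> edist x y" for x y
    unfolding edist_def[of x y]
  proof (rule INF_greatest, safe)
    fix \<gamma> assume "piecewise_C1_curve \<A> \<gamma>"
    then show "edist (\<gamma> 1) (\<gamma> 0) \<le> curve_length \<A> G \<gamma>"
      using edist_le[OF piecewise_C1_curve_reverse[of \<A> \<gamma>]] curve_length_reverse[of \<gamma>]
      by simp
  qed
  then show ?thesis by (simp add: antisym)
qed

lemma edist_triangle: "edist x z \<le> edist x y + edist y z"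
proof (rule ennreal_le_epsilon)
  fix e :: real
  assume fin: "edist x y + edist y z < top" and "0 < e"
  then have "edist x y < edist x y + ennreal (e / 2)" "edist y z < edist y z + ennreal (e / 2)"
    by (auto simp: ennreal_add_left_cancel_less less_top)
  then obtain \<sigma> \<tau> where \<sigma>: "piecewise_C1_curve \<A> \<sigma>" "\<sigma> 0 = x" "\<sigma> 1 = y" "curve_length \<A> G \<sigma> < edist x y + ennreal (e / 2)"
    and \<tau>: "piecewise_C1_curve \<A> \<tau>" "\<tau> 0 = y" "\<tau> 1 = z" "curve_length \<A> G \<tau> < edist y z + ennreal (e / 2)"
    by (metis edist_lessE)
  have "edist ((\<sigma> +++ \<tau>) 0) ((\<sigma> +++ \<tau>) 1) \<le> curve_length \<A> G (\<sigma> +++ \<tau>)"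
    using \<sigma> \<tau> by (intro edist_le piecewise_C1_curve_join) auto
  also have "\<dots> \<le> (edist x y + ennreal (e / 2)) + (edist y z + ennreal (e / 2))"
    using curve_length_join \<sigma>(4) \<tau>(4) by (meson add_mono less_imp_le order_trans)
  also have "\<dots> = edist x y + edist y z + (ennreal (e / 2) + ennreal (e / 2))"
    by (simp add: ac_simps)
  also have "ennreal (e / 2) + ennreal (e / 2) = ennreal e"
    using \<open>0 < e\<close> by (simp add: ennreal_plus[symmetric] del: ennreal_plus)
  finally show "edist x z \<le> edist x y + edist y z + ennreal e"
    using \<sigma>(2) \<tau>(3) by (simp add: joinpaths_def)
qed

text \<open>The length of a segment in the chart \<open>c\<close> is estimated in a chart of the atlas at \<open>p\<close>.\<close>

lemma segment_edist_le:
  assumes c: "smooth_chart \<A> c" and p: "p \<in> fst c"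
  obtains R C where "R > 0" "C \<ge> 0" "cball (snd c p) R \<subseteq> snd c ` fst c"
    "\<And>u v. u \<in> cball (snd c p) R \<Longrightarrow> v \<in> cball (snd c p) R \<Longrightarrow>
      edist (inv_into (fst c) (snd c) u) (inv_into (fst c) (snd c) v) \<le> ennreal (C * norm (v - u))"
proof -
  have ic: "is_chart c" and comp: "\<And>c'. c' \<in> \<A> \<Longrightarrow> compatible c c'"
    using c by (auto simp: smooth_chart_def)
  \<comment> \<open>The components of \<open>G\<close> are constrained only in the charts of
    \<open>\<A>\<close>, while \<open>c\<close> may merely belong to the maximal atlas.\<close>
  obtain a where a: "a \<in> \<A>" "p \<in> fst a" by (rule atlas_cover)
  note ia = atlas_chart[OF a(1)]
  let ?\<psi> = "inv_into (fst c) (snd c)" and ?W = "snd c ` (fst c \<inter> fst a)"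
  let ?\<tau> = "transition c a"
  define D where "D u = frechet_derivative ?\<tau> (at u)" for u
  define Q where "Q u h = D u h \<bullet> (G a (?\<tau> u) *v D u h)" for u h
  have "open ?W"
    by (intro chart_open_map[OF ic] open_Int chart_open ic ia) auto
  then obtain R where R: "R > 0" "cball (snd c p) R \<subseteq> ?W"
    using p a(2) unfolding open_contains_cball by blast
  have psi_W: "?\<psi> u \<in> fst c" "?\<psi> u \<in> fst a" "snd c (?\<psi> u) = u" "?\<tau> u = snd a (?\<psi> u)" if "u \<in> ?W" for u
    using that chart_inv[OF ic] by (auto simp: transition_def)
  have der: "(?\<tau> has_derivative D u) (at u)" if "u \<in> ?W" for u
    using transition_derivative(1)[OF ic ia comp[OF a(1)], of "?\<psi> u"] psi_W[OF that] by (simp add: D_def)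
  have linD: "linear (D u)" if "u \<in> ?W" for u
    using der[OF that] by (rule has_derivative_linear)
  have contD: "continuous_on ?W (\<lambda>u. D u h)" for h
    unfolding D_def by (rule transition_derivative(2)[OF ic ia comp[OF a(1)]])
  have "continuous_on ?W ?\<tau>"
    by (rule transition_derivative(3)[OF ic ia comp[OF a(1)]])
  then have contG: "continuous_on ?W (\<lambda>u. G a (?\<tau> u))"
    by (rule continuous_on_compose2[OF form_continuous[OF a(1)]]) (use psi_W in auto)
  \<comment> \<open>Smoothness gives continuity of \<open>D u h\<close> in \<open>u\<close> for
    fixed \<open>h\<close>. Linearity in \<open>h\<close> turns this into joint continuity.\<close>
  have D_eq: "D u h = h $ 1 *\<^sub>R D u (axis 1 1) + h $ 2 *\<^sub>R D u (axis 2 1)" if "u \<in> ?W" for u h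
  proof -
    have "h = h $ 1 *\<^sub>R axis 1 1 + h $ 2 *\<^sub>R axis 2 1"
      by (simp add: vec_eq_iff forall_2 axis_def)
    then have "D u h = D u (h $ 1 *\<^sub>R axis 1 1 + h $ 2 *\<^sub>R axis 2 1)"
      by (rule arg_cong)
    then show ?thesis
      by (simp only: linear_add[OF linD[OF that]] linear_scale[OF linD[OF that]])
  qed
  let ?K = "cball (snd c p) R \<times> sphere (0::real^2) 1"
  have fst_W: "fst ` ?K \<subseteq> ?W" using R(2) by auto
  have cD: "continuous_on ?K (\<lambda>z. D (fst z) (snd z))"
  proof -
    have "continuous_on ?K (\<lambda>z. snd z $ 1 *\<^sub>R D (fst z) (axis 1 1) + snd z $ 2 *\<^sub>R D (fst z) (axis 2 1))"
      by (intro continuous_on_add continuous_on_scaleR continuous_on_component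
          continuous_on_compose2[OF contD _ fst_W] continuous_on_fst continuous_on_snd continuous_on_id)
    moreover have "D (fst z) (snd z)
        = snd z $ 1 *\<^sub>R D (fst z) (axis 1 1) + snd z $ 2 *\<^sub>R D (fst z) (axis 2 1)" if "z \<in> ?K" for z
      using fst_W that by (intro D_eq) blast
    ultimately show ?thesis by (rule continuous_on_eq[OF _ sym])
  qed
  have cG: "continuous_on ?K (\<lambda>z. G a (?\<tau> (fst z)))"
    by (rule continuous_on_compose2[OF contG _ fst_W]) (intro continuous_intros)
  have cD_nth: "continuous_on ?K (\<lambda>z. D (fst z) (snd z) $ i)" for i
    by (rule continuous_on_component[OF cD])
  have cG_nth: "continuous_on ?K (\<lambda>z. G a (?\<tau> (fst z)) $ i $ j)" for i j
    by (intro continuous_on_component[OF continuous_on_component[OF cG]])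
  have cQ: "continuous_on ?K (\<lambda>z. Q (fst z) (snd z))"
    unfolding Q_def inner_vec_def matrix_vector_mult_def sum_2
    by (simp only: vec_lambda_beta inner_real_def)
      (intro continuous_on_add continuous_on_mult cD_nth cG_nth)
  have "compact ?K" by (intro compact_Times compact_cball compact_sphere)
  then have "bounded ((\<lambda>z. Q (fst z) (snd z)) ` ?K)"
    using cQ by (intro compact_imp_bounded compact_continuous_image)
  then obtain B where "\<forall>q \<in> (\<lambda>z. Q (fst z) (snd z)) ` ?K. norm q \<le> B"
    unfolding bounded_iff by blast
  then have Q_bound: "norm (Q (fst z) (snd z)) \<le> B" if "z \<in> ?K" for z
    using that by blast
  then have B: "Q u h \<le> \<bar>B\<bar>" if "u \<in> cball (snd c p) R" "norm h = 1" for u h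
    using Q_bound[of "(u, h)"] that by simp
  \<comment> \<open>\<open>Q u\<close> is homogeneous of degree 2, so the bound on the compact unit
    sphere extends to all vectors.\<close>
  have Q_le: "sqrt (Q u h) \<le> sqrt \<bar>B\<bar> * norm h" if u: "u \<in> cball (snd c p) R" for u h
  proof (cases "h = 0")
    case True
    then show ?thesis using linear_0[OF linD] u R(2) by (auto simp: Q_def)
  next
    case False
    define e where "e = h /\<^sub>R norm h"
    have e: "norm e = 1" "h = norm h *\<^sub>R e" using False by (auto simp: e_def)
    have "D u h = D u (norm h *\<^sub>R e)"
      using e(2) by (rule arg_cong)
    also have "\<dots> = norm h *\<^sub>R D u e"
      using u R(2) by (intro linear_scale linD) auto
    finally have "D u h = norm h *\<^sub>R D u e" .
    then have "Q u h = (norm h)\<^sup>2 * Q u e"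
      by (simp add: Q_def power2_eq_square matrix_vector_mult_scaleR)
    also have "\<dots> \<le> (norm h)\<^sup>2 * \<bar>B\<bar>"
      by (intro mult_left_mono B u e) simp
    finally have "sqrt (Q u h) \<le> sqrt ((norm h)\<^sup>2 * \<bar>B\<bar>)" by simp
    then show ?thesis by (simp add: real_sqrt_mult mult.commute)
  qed
  show thesis
  proof
    show "R > 0" "sqrt \<bar>B\<bar> \<ge> 0" "cball (snd c p) R \<subseteq> snd c ` fst c"
      using R by auto
    fix u v assume uv: "u \<in> cball (snd c p) R" "v \<in> cball (snd c p) R"
    define \<gamma> where "\<gamma> = ?\<psi> \<circ> linepath u v"
    have "closed_segment u v \<subseteq> cball (snd c p) R"
      by (intro closed_segment_subset uv convex_cball)
    then have seg: "linepath u v t \<in> cball (snd c p) R" if "t \<in> {0..1}" for t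
      using linepath_in_path[OF that] by blast
    then have segW: "linepath u v t \<in> ?W" if "t \<in> {0..1}" for t
      using R(2) that by blast
    have dseg: "(linepath u v has_vector_derivative v - u) (at t)" for t
      by (rule has_vector_derivative_linepath_within)
    have comp_eq: "snd c' \<circ> \<gamma> = transition c c' \<circ> linepath u v" for c'
      by (simp add: \<gamma>_def transition_def o_assoc)
    have cont_seg: "continuous_on A (linepath u v)" for A
      by (simp add: linepath_def) (intro continuous_intros)
    have curve: "piecewise_C1_curve \<A> \<gamma>"
      unfolding piecewise_C1_curve_def
    proof (intro conjI ballI allI impI)
      show "continuous_on {0..1} \<gamma>"
        unfolding \<gamma>_def
        by (intro continuous_on_compose cont_seg continuous_on_subset[OF chart_inv_continuous[OF ic]])
          (use segW in blast)
      fix c' and r s :: real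
      assume c': "c' \<in> \<A>" and rs: "0 \<le> r \<and> s \<le> 1 \<and> \<gamma> ` {r..s} \<subseteq> fst c'"
      have mem: "?\<psi> (linepath u v t) \<in> fst c \<inter> fst c'" "snd c (?\<psi> (linepath u v t)) = linepath u v t" if "t \<in> {r..s}" for t
      proof -
        have "linepath u v t \<in> ?W" using that rs by (intro segW) auto
        moreover have "\<gamma> t \<in> fst c'" using rs that by blast
        ultimately show "?\<psi> (linepath u v t) \<in> fst c \<inter> fst c'" "snd c (?\<psi> (linepath u v t)) = linepath u v t"
          using psi_W(1,3)[of "linepath u v t"] by (simp_all add: \<gamma>_def)
      qed
      then have sub: "linepath u v ` {r..s} \<subseteq> snd c ` (fst c \<inter> fst c')"
        by (metis image_eqI image_subsetI)
      let ?E = "\<lambda>t. frechet_derivative (transition c c') (at (linepath u v t)) (v - u)"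
      have "(snd c' \<circ> \<gamma> has_vector_derivative ?E t) (at t)" if "t \<in> {r..s}" for t
        unfolding comp_eq
        using transition_derivative(1)[OF ic atlas_chart[OF c'] comp[OF c'], of "?\<psi> (linepath u v t)"] mem[OF that]
        by (intro has_vector_derivative_chain dseg) auto
      moreover have "continuous_on {r..s} ?E"
        by (rule continuous_on_compose2[OF transition_derivative(2)[OF ic atlas_chart[OF c'] comp[OF c']] cont_seg sub])
      ultimately have "snd c' \<circ> \<gamma> C1_differentiable_on {r..s}"
        unfolding C1_differentiable_on_def by (intro exI[of _ ?E] conjI ballI)
      then show "snd c' \<circ> \<gamma> piecewise_C1_differentiable_on {r..s}"
        by (rule C1_differentiable_imp_piecewise)
    qed
    have "speed \<A> G \<gamma> t \<le> sqrt \<bar>B\<bar> * norm (v - u)" if t: "t \<in> {0<..<1}" for t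
    proof -
      have tW: "linepath u v t \<in> ?W" using t by (intro segW) auto
      have "isCont \<gamma> t"
        using curve t continuous_on_interior[of "{0..1}" \<gamma> t]
        by (simp add: piecewise_C1_curve_def interior_atLeastAtMost_real)
      moreover have "(snd a \<circ> \<gamma> has_vector_derivative D (linepath u v t) (v - u)) (at t)"
        unfolding comp_eq by (intro has_vector_derivative_chain dseg der tW)
      ultimately have "speed \<A> G \<gamma> t = sqrt (Q (linepath u v t) (v - u))"
        using psi_W[OF tW] a by (subst speed_eq[of a]) (auto simp: \<gamma>_def Q_def)
      then show ?thesis using Q_le seg t by auto
    qed
    then have speed_le: "ennreal (speed \<A> G \<gamma> t) * indicator {0..1} t
        \<le> ennreal (sqrt \<bar>B\<bar> * norm (v - u)) * indicator {0..1} t" if "t \<noteq> 0 \<and> t \<noteq> 1" for t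
      using that by (auto intro!: ennreal_leI split: split_indicator)
    \<comment> \<open>The speed estimate uses two-sided continuity, known only inside the interval;
      the endpoints are null.\<close>
    have "AE t in lborel. t \<noteq> (0::real) \<and> t \<noteq> 1"
      by (intro AE_conjI AE_lborel_singleton)
    then have "AE t in lborel. ennreal (speed \<A> G \<gamma> t) * indicator {0..1} t
        \<le> ennreal (sqrt \<bar>B\<bar> * norm (v - u)) * indicator {0..1} t"
      by eventually_elim (rule speed_le)
    then have "curve_length \<A> G \<gamma> \<le> (\<integral>\<^sup>+ t. ennreal (sqrt \<bar>B\<bar> * norm (v - u)) * indicator {0..1::real} t \<partial>lborel)"
      unfolding curve_length_def by (rule nn_integral_mono_AE)
    also have "\<dots> = ennreal (sqrt \<bar>B\<bar> * norm (v - u))"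
      by (simp add: nn_integral_cmult_indicator)
    finally show "edist (?\<psi> u) (?\<psi> v) \<le> ennreal (sqrt \<bar>B\<bar> * norm (v - u))"
      using edist_le[OF curve] by (simp add: \<gamma>_def linepath_def)
  qed
qed

text \<open>The curve is followed up to its first exit from the coordinate ball; the component of its
  velocity in the exit direction integrates to \<open>R\<close>.\<close>

lemma curve_length_ge_escape:
  assumes c: "c \<in> \<A>" and p: "p \<in> fst c" and R: "R > 0" "cball (snd c p) R \<subseteq> snd c ` fst c"
    and m: "m \<ge> 0" "\<And>u v. u \<in> cball (snd c p) R \<Longrightarrow> m * norm v \<le> sqrt (v \<bullet> (G c u *v v))"
    and \<gamma>: "piecewise_C1_curve \<A> \<gamma>" "\<gamma> 0 = p" "\<gamma> 1 \<notin> inv_into (fst c) (snd c) ` ball (snd c p) R"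
  shows "ennreal (m * R) \<le> curve_length \<A> G \<gamma>"
proof (cases "curve_length \<A> G \<gamma> = top \<or> m = 0")
  case False
  note ic = atlas_chart[OF c]
  let ?\<psi> = "inv_into (fst c) (snd c)"
  let ?B = "?\<psi> ` ball (snd c p) R" and ?K = "?\<psi> ` cball (snd c p) R"
  have \<gamma>_cont: "continuous_on {0..1} \<gamma>"
    using \<gamma>(1) by (simp add: piecewise_C1_curve_def)
  have "open ?B"
    using R(2) ball_subset_cball by (intro chart_inv_open_map[OF ic] open_ball) blast
  have "compact ?K"
    by (intro compact_continuous_image continuous_on_subset[OF chart_inv_continuous[OF ic]] R(2) compact_cball)
  then have "closed ?K" by (rule compact_imp_closed)
  \<comment> \<open>\<open>T\<close> is closed because the coordinate ball is open, so the first
    exit time is attained.\<close>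
  define T where "T = {0..1} \<inter> \<gamma> -` (- ?B)"
  have "closed T"
    unfolding T_def using \<open>open ?B\<close> by (intro continuous_closed_preimage \<gamma>_cont) auto
  moreover have "1 \<in> T" "bdd_below T"
    using \<gamma>(3) by (auto simp: T_def bdd_below_def)
  moreover define t0 where "t0 = Inf T"
  ultimately have "t0 \<in> T" by (metis closed_contains_Inf empty_iff)
  have before: "\<gamma> t \<in> ?B" if "0 \<le> t" "t < t0" for t
    using cInf_lower[OF _ \<open>bdd_below T\<close>, of t] that \<open>t0 \<in> T\<close> by (force simp: t0_def T_def)
  have "p \<in> ?B"
    using p R(1) by (intro image_eqI[of _ _ "snd c p"]) (simp_all add: chart_inv[OF ic])
  then have t0: "0 < t0" "t0 \<le> 1" "\<gamma> t0 \<notin> ?B"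
    using \<open>t0 \<in> T\<close> \<gamma>(2) by (cases "t0 = 0"; force simp: T_def)+
  \<comment> \<open>At \<open>t0\<close> the curve is outside the open ball but is a limit of points
    inside it. It is therefore still in the chart, at coordinate distance exactly
    \<open>R\<close>.\<close>
  have "closed ({0..t0} \<inter> \<gamma> -` ?K)"
    using t0 by (intro continuous_closed_preimage continuous_on_subset[OF \<gamma>_cont] \<open>closed ?K\<close>) auto
  moreover have "{0..<t0} \<subseteq> {0..t0} \<inter> \<gamma> -` ?K"
    using before ball_subset_cball by fastforce
  ultimately have "closure {0..<t0} \<subseteq> {0..t0} \<inter> \<gamma> -` ?K"
    by (rule closure_minimal[rotated])
  then have inK: "\<gamma> t \<in> ?K" if "t \<in> {0..t0}" for t
    using that t0(1) by auto
  have K: "z \<in> fst c" "snd c z \<in> cball (snd c p) R" if "z \<in> ?K" for z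
  proof -
    from that obtain u where u: "u \<in> cball (snd c p) R" "z = ?\<psi> u" by blast
    with R(2) have "u \<in> snd c ` fst c" by blast
    with u show "z \<in> fst c" "snd c z \<in> cball (snd c p) R"
      by (simp_all add: inv_into_into f_inv_into_f)
  qed
  have dist_t0: "norm (snd c (\<gamma> t0) - snd c p) = R"
  proof -
    have z: "\<gamma> t0 \<in> fst c" "snd c (\<gamma> t0) \<in> cball (snd c p) R"
      using K inK[of t0] t0(1) by auto
    have "snd c (\<gamma> t0) \<notin> ball (snd c p) R"
      using t0(3) chart_inv[OF ic z(1)] by (metis imageI)
    with z(2) show ?thesis by (auto simp: dist_norm norm_minus_commute)
  qed
  define e where "e = (snd c (\<gamma> t0) - snd c p) /\<^sub>R R"
  have e: "norm e = 1" "(snd c (\<gamma> t0) - snd c p) \<bullet> e = R"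
    using dist_t0 R(1) by (auto simp: e_def dot_square_norm power2_eq_square)
  have "(snd c \<circ> \<gamma>) piecewise_C1_differentiable_on {0..t0}"
    using t0 K inK by (intro piecewise_C1_curveD[OF \<gamma>(1) c]) auto
  then obtain S D where S: "finite S" and cont: "continuous_on {0..t0} (snd c \<circ> \<gamma>)"
    and D: "\<And>t. t \<in> {0..t0} - S \<Longrightarrow> (snd c \<circ> \<gamma> has_vector_derivative D t) (at t)"
    and contD: "continuous_on ({0..t0} - S) D"
    unfolding piecewise_C1_differentiable_on_def C1_differentiable_on_def by blast
  have "((\<lambda>t. D t \<bullet> e) has_integral (snd c (\<gamma> t0) - snd c p) \<bullet> e) {0..t0}"
  proof -
    have "((\<lambda>t. (snd c \<circ> \<gamma>) t \<bullet> e) has_vector_derivative D t \<bullet> e) (at t)" if "t \<in> {0..t0} - S" for t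
      using D[OF that] by (rule bounded_linear.has_vector_derivative[OF bounded_linear_inner_left])
    then have "((\<lambda>t. D t \<bullet> e) has_integral (snd c \<circ> \<gamma>) t0 \<bullet> e - (snd c \<circ> \<gamma>) 0 \<bullet> e) {0..t0}"
      using t0 cont S by (intro fundamental_theorem_of_calculus_strong[of S]) (auto intro!: continuous_intros)
    then show ?thesis by (simp add: inner_diff_left \<gamma>(2))
  qed
  then have int_D: "((\<lambda>t. D t \<bullet> e) has_integral R) {0..t0}"
    by (simp only: e(2))
  let ?A = "{0<..<t0} - S"
  \<comment> \<open>A measurable stand-in for the speed: the positive part of the velocity component
    in direction \<open>e\<close>, set to 0 off the times with a known derivative.\<close>
  define g where "g t = indicator ?A t *\<^sub>R max 0 (D t \<bullet> e)" for t
  have "continuous_on ?A (\<lambda>t. max 0 (D t \<bullet> e))"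
    by (intro continuous_intros continuous_on_subset[OF contD]) auto
  moreover have "?A \<in> sets borel"
    using S by (intro sets.Diff borel_open borel_closed finite_imp_closed) auto
  ultimately have [measurable]: "g \<in> borel_measurable borel"
    unfolding g_def by (intro borel_measurable_continuous_on_indicator)
  have "ennreal m * ennreal (g t) \<le> ennreal (speed \<A> G \<gamma> t) * indicator {0..1} t" for t
  proof (cases "t \<in> ?A")
    case True
    have "isCont \<gamma> t"
      using True t0 continuous_on_interior[OF \<gamma>_cont, of t]
      by (simp add: interior_atLeastAtMost_real)
    then have "speed \<A> G \<gamma> t = sqrt (D t \<bullet> (G c (snd c (\<gamma> t)) *v D t))"
      using True K(1) inK by (intro speed_eq c D) auto
    moreover have "m * max 0 (D t \<bullet> e) \<le> m * norm (D t)"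
      using m(1) norm_cauchy_schwarz[of "D t" e] e(1) by (intro mult_left_mono) auto
    moreover have "m * norm (D t) \<le> sqrt (D t \<bullet> (G c (snd c (\<gamma> t)) *v D t))"
      using True K(2) inK by (intro m) auto
    ultimately have "m * g t \<le> speed \<A> G \<gamma> t"
      using True by (simp add: g_def)
    then show ?thesis
      using True t0 m(1) by (simp add: ennreal_mult'[symmetric] ennreal_leI)
  qed (simp add: g_def)
  then have "(\<integral>\<^sup>+ t. ennreal m * ennreal (g t) \<partial>lborel) \<le> curve_length \<A> G \<gamma>"
    unfolding curve_length_def by (rule nn_integral_mono)
  then have le: "ennreal m * (\<integral>\<^sup>+ t. ennreal (g t) \<partial>lborel) \<le> curve_length \<A> G \<gamma>"
    by (simp add: nn_integral_cmult)
  \<comment> \<open>Finite length makes \<open>g\<close> integrable, so its integral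
    \<open>r\<close> can be compared with that of the signed integrand, which is \<open>R\<close> by
    the fundamental theorem of calculus.\<close>
  then have "(\<integral>\<^sup>+ t. ennreal (g t) \<partial>lborel) \<noteq> top"
    using False m(1) by (auto simp: top_unique ennreal_mult_top)
  then obtain r where r: "0 \<le> r" "(\<integral>\<^sup>+ t. ennreal (g t) \<partial>lborel) = ennreal r"
    by (cases "\<integral>\<^sup>+ t. ennreal (g t) \<partial>lborel") auto
  then have int_g: "(g has_integral r) UNIV"
    by (intro nn_integral_has_integral) (auto simp: g_def)
  have "((\<lambda>t. indicator ?A t *\<^sub>R (D t \<bullet> e)) has_integral R) UNIV"
  proof -
    have "((\<lambda>t. if t \<in> {0..t0} then D t \<bullet> e else 0) has_integral R) UNIV"
      using int_D by (simp only: has_integral_restrict_UNIV)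
    then show ?thesis
      by (rule has_integral_spike_finite[of "insert 0 (insert t0 S)", rotated 2])
        (use S in \<open>auto split: split_indicator\<close>)
  qed
  then have "R \<le> r"
    using int_g by (rule has_integral_le) (auto simp: g_def split: split_indicator)
  have "ennreal (m * R) \<le> ennreal (m * r)"
    using \<open>R \<le> r\<close> m(1) by (intro ennreal_leI mult_left_mono)
  with le r m(1) show ?thesis by (simp add: ennreal_mult)
qed auto

text \<open>Every curve from \<open>x\<close> to \<open>y\<close> must leave a coordinate ball about
  \<open>x\<close> that misses \<open>y\<close>. The minimum of the metric over the compact ball
  times the unit sphere gives the positive constant of the escape estimate.\<close>

lemma edist_pos:
  assumes "x \<noteq> y"
  shows "edist x y > 0"
proof -
  obtain c where c: "c \<in> \<A>" "x \<in> fst c" by (rule atlas_cover)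
  note ic = atlas_chart[OF c(1)]
  have "open (snd c ` (fst c - {y}))"
    by (intro chart_open_map[OF ic] open_Diff chart_open ic) auto
  then obtain R where R: "R > 0" "cball (snd c x) R \<subseteq> snd c ` (fst c - {y})"
    using c assms unfolding open_contains_cball by blast
  let ?K = "cball (snd c x) R \<times> sphere (0::real^2) 1"
  let ?Q = "\<lambda>z. snd z \<bullet> (G c (fst z) *v snd z)"
  have KU: "cball (snd c x) R \<subseteq> snd c ` fst c" using R(2) by blast
  have cG: "continuous_on ?K (\<lambda>z. G c (fst z))"
    by (rule continuous_on_compose2[OF form_continuous[OF c(1)]])
      (use KU in \<open>auto intro!: continuous_on_fst continuous_on_id\<close>)
  have cG_nth: "continuous_on ?K (\<lambda>z. G c (fst z) $ i $ j)" for i j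
    by (intro continuous_on_component[OF continuous_on_component[OF cG]])
  have snd_nth: "continuous_on ?K (\<lambda>z. snd z $ i)" for i
    by (intro continuous_on_component continuous_on_snd continuous_on_id)
  have "continuous_on ?K ?Q"
    unfolding inner_vec_def matrix_vector_mult_def sum_2
    by (simp only: vec_lambda_beta inner_real_def)
      (intro continuous_on_add continuous_on_mult snd_nth cG_nth)
  moreover have "compact ?K" by (intro compact_Times compact_cball compact_sphere)
  moreover have "(snd c x, axis 1 1) \<in> ?K" using R(1) by simp
  ultimately obtain z0 where z0: "z0 \<in> ?K" "\<And>z. z \<in> ?K \<Longrightarrow> ?Q z0 \<le> ?Q z"
    using continuous_attains_inf[of ?K ?Q] by blast
  have "snd z0 \<noteq> 0" using z0(1) by auto
  then have pos: "?Q z0 > 0"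
    using z0(1) KU by (intro form_pos c(1)) auto
  have m: "sqrt (?Q z0) * norm v \<le> sqrt (v \<bullet> (G c u *v v))" if u: "u \<in> cball (snd c x) R" for u v
  proof (cases "v = 0")
    case False
    define e where "e = v /\<^sub>R norm v"
    have e: "norm e = 1" "v = norm v *\<^sub>R e" using False by (auto simp: e_def)
    have "v \<bullet> (G c u *v v) = (norm v *\<^sub>R e) \<bullet> (G c u *v (norm v *\<^sub>R e))"
      using e(2) by (rule arg_cong)
    also have "\<dots> = (norm v)\<^sup>2 * (e \<bullet> (G c u *v e))"
      by (simp add: power2_eq_square matrix_vector_mult_scaleR)
    also have "\<dots> \<ge> (norm v)\<^sup>2 * ?Q z0"
      using z0(2)[of "(u, e)"] u e(1) by (intro mult_left_mono) auto
    finally have "sqrt ((norm v)\<^sup>2 * ?Q z0) \<le> sqrt (v \<bullet> (G c u *v v))" by simp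
    then show ?thesis by (simp add: real_sqrt_mult mult.commute)
  qed simp
  have y: "y \<notin> inv_into (fst c) (snd c) ` ball (snd c x) R"
  proof
    assume "y \<in> inv_into (fst c) (snd c) ` ball (snd c x) R"
    then obtain u where "u \<in> ball (snd c x) R" "y = inv_into (fst c) (snd c) u" by blast
    moreover from this R(2) obtain z where "z \<in> fst c - {y}" "u = snd c z"
      using ball_subset_cball by blast
    ultimately show False using chart_inv[OF ic, of z] by auto
  qed
  have "ennreal (sqrt (?Q z0) * R) \<le> edist x y"
    unfolding edist_def
  proof (rule INF_greatest, safe)
    fix \<gamma> assume \<gamma>: "piecewise_C1_curve \<A> \<gamma>" "x = \<gamma> 0" "y = \<gamma> 1"
    show "ennreal (sqrt (?Q z0) * R) \<le> curve_length \<A> G \<gamma>"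
      using y pos \<gamma> m by (intro curve_length_ge_escape[OF c R(1) KU _ _ \<gamma>(1)]) auto
  qed
  moreover have "0 < ennreal (sqrt (?Q z0) * R)"
    using pos R(1) by simp
  ultimately show ?thesis by (rule less_le_trans[rotated])
qed

text \<open>Neighbourhoods in the given topology are small for the distance, by the estimate for
  coordinate segments. This lets continuity control dynamical balls.\<close>

lemma edist_small:
  assumes "e > 0"
  shows "\<forall>\<^sub>F y in nhds x. edist x y < ennreal e"
proof -
  obtain c where c: "c \<in> \<A>" "x \<in> fst c" by (rule atlas_cover)
  note ic = atlas_chart[OF c(1)]
  obtain R C where R: "R > 0" "C \<ge> 0"
    and le: "\<And>u v. u \<in> cball (snd c x) R \<Longrightarrow> v \<in> cball (snd c x) R \<Longrightarrow>
      edist (inv_into (fst c) (snd c) u) (inv_into (fst c) (snd c) v) \<le> ennreal (C * norm (v - u))"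
    by (rule segment_edist_le[OF atlas_smooth_chart[OF c(1)] c(2)], rule that)
  define r where "r = min R (e / (C + 1))"
  have r: "r > 0" "r \<le> R" "C * r < e"
  proof -
    show "r > 0" "r \<le> R" using R assms by (auto simp: r_def)
    then have "C * r < (C + 1) * r" by simp
    also have "\<dots> \<le> (C + 1) * (e / (C + 1))"
      using R(2) by (intro mult_left_mono) (auto simp: r_def)
    finally show "C * r < e" using R(2) by simp
  qed
  let ?V = "fst c \<inter> snd c -` ball (snd c x) r"
  have "open ?V"
    by (rule continuous_open_preimage[OF chart_continuous[OF ic] chart_open[OF ic] open_ball])
  then have "\<forall>\<^sub>F y in nhds x. y \<in> ?V"
    using c(2) r(1) by (intro eventually_nhds_in_open) auto
  then show ?thesis
  proof (rule eventually_mono)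
    fix y assume y: "y \<in> ?V"
    then have "edist x y \<le> ennreal (C * norm (snd c y - snd c x))"
      using le[of "snd c x" "snd c y"] R(1) r(2) c(2) by (simp add: chart_inv[OF ic])
    also have "\<dots> < ennreal e"
    proof (rule ennreal_lessI[OF assms])
      have "C * norm (snd c y - snd c x) \<le> C * r"
        using y R(2) by (intro mult_left_mono) (auto simp: dist_norm norm_minus_commute)
      then show "C * norm (snd c y - snd c x) < e" using r(3) by simp
    qed
    finally show "edist x y < ennreal e" .
  qed
qed

text \<open>The neighbourhood estimate is evaluated at the point itself, which avoids examining the
  speed of a constant curve.\<close>

lemma edist_self [simp]: "edist x x = 0"
proof (rule ccontr)
  assume "edist x x \<noteq> 0"
  then have "\<exists>e>0. ennreal e \<le> edist x x"
  proof (cases "edist x x")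
    case (real r)
    then show ?thesis using \<open>edist x x \<noteq> 0\<close> by (intro exI[of _ r]) auto
  qed (intro exI[of _ 1], auto)
  then obtain e where "e > 0" "ennreal e \<le> edist x x" by blast
  with eventually_nhds_x_imp_x[OF edist_small[OF \<open>e > 0\<close>, of x]] show False
    by simp
qed

lemma rdist_eq: "rdist \<A> G x y = enn2real (edist x y)"
  by (simp add: rdist_def edist_def)

end

section \<open>Compact connected surfaces: the distance and the C0 metric\<close>

locale riemannian_surface = riemannian_atlas \<A> G
  for \<A> :: "'a::t2_space chart set" and G +
  assumes compact_UNIV: "compact (UNIV :: 'a set)" and connected_UNIV: "connected (UNIV :: 'a set)"
begin

abbreviation dist_S :: "'a \<Rightarrow> 'a \<Rightarrow> real" where "dist_S \<equiv> rdist \<A> G"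

text \<open>The points at finite distance from \<open>x\<close> form a nonempty set that is open
  with open complement, so connectedness leaves nothing outside it.\<close>

lemma edist_finite: "edist x y < top"
proof -
  let ?S = "{y. edist x y < top}"
  have near: "\<exists>T. open T \<and> y \<in> T \<and> (\<forall>z\<in>T. edist y z < top)" for y
  proof -
    have "\<forall>\<^sub>F z in nhds y. edist y z < ennreal 1" by (rule edist_small) simp
    then have "\<forall>\<^sub>F z in nhds y. edist y z < top"
      by (rule eventually_mono) (erule less_trans, simp)
    then show ?thesis
      by (simp only: eventually_nhds)
  qed
  have "open ?S"
  proof (rule iffD2[OF open_subopen], rule ballI)
    fix y assume "y \<in> ?S"
    then have y: "edist x y < top" by simp
    obtain T where T: "open T" "y \<in> T" "\<forall>z\<in>T. edist y z < top" using near by blast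
    have "edist x z < top" if "z \<in> T" for z
      using y T(3) that by (intro le_less_trans[OF edist_triangle[of x z y]]) simp
    with T show "\<exists>T. open T \<and> y \<in> T \<and> T \<subseteq> ?S" by blast
  qed
  moreover have "open (- ?S)"
  proof (rule iffD2[OF open_subopen], rule ballI)
    fix y assume "y \<in> - ?S"
    then have y: "\<not> edist x y < top" by simp
    obtain T where T: "open T" "y \<in> T" "\<forall>z\<in>T. edist y z < top" using near by blast
    have "\<not> edist x z < top" if "z \<in> T" for z
    proof
      assume "edist x z < top"
      then have "edist x y < top"
        using T(3) that edist_commute[of z y] by (intro le_less_trans[OF edist_triangle[of x y z]]) simp
      with y show False by simp
    qed
    with T show "\<exists>T. open T \<and> y \<in> T \<and> T \<subseteq> - ?S" by blast
  qed
  moreover have "x \<in> ?S" by simp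
  ultimately have "- ?S = {}"
    using connectedD[OF connected_UNIV, of ?S "- ?S"] by blast
  then show ?thesis by blast
qed

lemma ennreal_dist: "ennreal (dist_S x y) = edist x y"
  using edist_finite by (simp add: rdist_eq)

lemma dist_nonneg [simp]: "0 \<le> dist_S x y"
  by (simp add: rdist_eq)

lemma dist_commute_S: "dist_S x y = dist_S y x"
  by (simp add: rdist_eq edist_commute)

lemma dist_triangle_S: "dist_S x z \<le> dist_S x y + dist_S y z"
  using edist_triangle[of x z y] by (simp add: ennreal_dist[symmetric] ennreal_plus[symmetric] del: ennreal_plus)

lemma dist_eq_0 [simp]: "dist_S x y = 0 \<longleftrightarrow> x = y"
  using edist_pos[of x y] ennreal_dist[of x y] by (cases "x = y") (auto simp: rdist_eq)

lemma dist_self [simp]: "dist_S x x = 0"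
  by simp

lemma dist_small: "e > 0 \<Longrightarrow> \<forall>\<^sub>F y in nhds x. dist_S x y < e"
  using edist_small[of e x] by (simp add: ennreal_dist[symmetric] ennreal_less_iff)

text \<open>Finitely many sets of radius 1 cover the compact surface. Boundedness is what makes the
  supremum in \<open>C0_dist\<close> meaningful.\<close>

lemma dist_bounded: obtains D where "\<And>x y. dist_S x y \<le> D"
proof -
  have "\<exists>T. open T \<and> x \<in> T \<and> (\<forall>y\<in>T. dist_S x y < 1)" for x
    using dist_small[of 1 x] by (auto simp: eventually_nhds)
  then obtain T where T: "\<And>x. open (T x)" "\<And>x. x \<in> T x" "\<And>x y. y \<in> T x \<Longrightarrow> dist_S x y < 1"
    by metis
  obtain F where F: "finite F" "UNIV \<subseteq> (\<Union>x\<in>F. T x)"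
    by (rule compactE_image[OF compact_UNIV, of UNIV T]) (use T in auto)
  fix x0 :: 'a
  let ?D = "(\<Sum>x\<in>F. dist_S x0 x) + 1"
  have D: "dist_S x0 y \<le> ?D" for y
  proof -
    obtain x where x: "x \<in> F" "y \<in> T x" using F(2) by blast
    then have "dist_S x0 x \<le> (\<Sum>x\<in>F. dist_S x0 x)"
      by (intro member_le_sum F) auto
    with dist_triangle_S[of x0 y x] T(3)[OF x(2)] show ?thesis by linarith
  qed
  have "dist_S x y \<le> ?D + ?D" for x y
    using dist_triangle_S[of x y x0] D[of x] D[of y] by (simp add: dist_commute_S)
  then show thesis by (rule that)
qed

lemma C0_dist_bdd: "bdd_above (range (\<lambda>x. max (dist_S (f x) (g x)) (dist_S (inv f x) (inv g x))))"
  by (rule dist_bounded) (auto intro!: bdd_aboveI2)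

lemma C0_dist_upper: "dist_S (f x) (g x) \<le> C0_dist dist_S f g" "dist_S (inv f x) (inv g x) \<le> C0_dist dist_S f g"
  using cSUP_upper[OF UNIV_I C0_dist_bdd[of f g], of x] by (auto simp: C0_dist_def)

lemma C0_dist_least:
  "(\<And>x. dist_S (f x) (g x) \<le> r) \<Longrightarrow> (\<And>x. dist_S (inv f x) (inv g x) \<le> r) \<Longrightarrow> C0_dist dist_S f g \<le> r"
  unfolding C0_dist_def by (rule cSUP_least) auto

text \<open>Bijectivity does not enter: \<open>inv\<close> is compared as a total function, and the
  first component of the maximum already separates maps.\<close>

lemma Metric_space_C0_dist: "Metric_space X (C0_dist dist_S)"
proof
  show nonneg: "0 \<le> C0_dist dist_S f g" for f g
    by (rule order_trans[OF dist_nonneg C0_dist_upper(1)])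
  show "C0_dist dist_S f g = C0_dist dist_S g f" for f g
    by (simp add: C0_dist_def dist_commute_S)
  show "C0_dist dist_S f g = 0 \<longleftrightarrow> f = g" for f g
  proof
    assume "C0_dist dist_S f g = 0"
    then have "dist_S (f x) (g x) = 0" for x
      using C0_dist_upper(1)[of f x g] by (intro antisym) auto
    then show "f = g" by auto
  next
    assume "f = g"
    then have "C0_dist dist_S f g \<le> 0" by (intro C0_dist_least) auto
    then show "C0_dist dist_S f g = 0" using nonneg[of f g] by simp
  qed
  show "C0_dist dist_S f h \<le> C0_dist dist_S f g + C0_dist dist_S g h" for f g h
  proof (rule C0_dist_least)
    fix x
    show "dist_S (f x) (h x) \<le> C0_dist dist_S f g + C0_dist dist_S g h"
      using dist_triangle_S[of "f x" "h x" "g x"] C0_dist_upper(1)[of f x g] C0_dist_upper(1)[of g x h]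
      by linarith
    show "dist_S (inv f x) (inv h x) \<le> C0_dist dist_S f g + C0_dist dist_S g h"
      using dist_triangle_S[of "inv f x" "inv h x" "inv g x"]
        C0_dist_upper(2)[of f x g] C0_dist_upper(2)[of g x h]
      by linarith
  qed
qed

end

section \<open>Twists of a disc in a chart\<close>

lemma continuous_on_vimage_borel:
  assumes "continuous_on A f" "A \<in> sets borel" "B \<in> sets borel"
  shows "A \<inter> f -` B \<in> sets borel"
  using measurable_sets[OF borel_measurable_continuous_on_restrict[OF assms(1)] assms(3)] assms(2)
  by (simp add: sets_restrict_space_iff space_restrict_space Int_commute)

lemma chart_image_borel:
  assumes "is_chart c" "B \<in> sets borel" "B \<subseteq> fst c"
  shows "snd c ` B \<in> sets borel"
proof -
  have "snd c ` B = snd c ` fst c \<inter> inv_into (fst c) (snd c) -` B"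
    using assms(3) chart_inv[OF assms(1)] by force
  then show ?thesis
    using continuous_on_vimage_borel[OF chart_inv_continuous[OF assms(1)] borel_open[OF chart_image_open[OF assms(1)]] assms(2)]
    by simp
qed

lemma chart_eventually:
  assumes c: "is_chart c" and x: "x \<in> fst c" and P: "\<forall>\<^sub>F y in nhds x. P y"
  obtains e where "e > 0" "\<And>v. dist v (snd c x) < e \<Longrightarrow> v \<in> snd c ` fst c \<and> P (inv_into (fst c) (snd c) v)"
proof -
  let ?\<psi> = "inv_into (fst c) (snd c)"
  obtain S where S: "open S" "x \<in> S" "\<And>y. y \<in> S \<Longrightarrow> P y"
    using P unfolding eventually_nhds by blast
  have "open (snd c ` fst c \<inter> ?\<psi> -` S)"
    by (rule continuous_open_preimage[OF chart_inv_continuous[OF c] chart_image_open[OF c] S(1)])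
  moreover have "snd c x \<in> snd c ` fst c \<inter> ?\<psi> -` S"
    using x S(2) by (simp add: chart_inv[OF c])
  ultimately obtain e where "e > 0" "\<And>v. dist v (snd c x) < e \<Longrightarrow> v \<in> snd c ` fst c \<inter> ?\<psi> -` S"
    unfolding open_dist by blast
  then show thesis using S(3) by (intro that[of e]) auto
qed

definition disc_twist :: "'a chart \<Rightarrow> real^2 \<Rightarrow> (real \<Rightarrow> real) \<Rightarrow> 'a \<Rightarrow> 'a" where
  "disc_twist c q w x = (if x \<in> fst c then inv_into (fst c) (snd c) (twist q w (snd c x)) else x)"

locale chart_disc =
  fixes c :: "'a::t2_space chart" and q :: "real^2" and \<rho> :: real
  assumes chart: "is_chart c" and disc: "\<rho> > 0" "cball q \<rho> \<subseteq> snd c ` fst c"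
begin

text \<open>Vanishing from \<open>\<rho>\<close> on confines the twist to a compact disc inside the
  chart. Closure under multiples makes inverses and iterates twists by profiles again.\<close>

definition profile :: "(real \<Rightarrow> real) \<Rightarrow> bool" where
  "profile w \<longleftrightarrow> continuous_on UNIV w \<and> (\<forall>r\<ge>\<rho>. w r = 0)"

lemma profile_mult: "profile w \<Longrightarrow> profile (\<lambda>r. a * w r)"
  and profile_minus: "profile w \<Longrightarrow> profile (\<lambda>r. - w r)"
  by (auto simp: profile_def intro!: continuous_intros)

lemma twist_in_chart:
  assumes "profile w" "u \<in> snd c ` fst c"
  shows "twist q w u \<in> snd c ` fst c"
proof (cases "norm (u - q) \<ge> \<rho>")
  case True
  then show ?thesis using assms by (simp add: twist_fixed profile_def)
next
  case False
  then have "twist q w u \<in> cball q \<rho>"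
    using norm_twist[of q w u] by (simp add: dist_norm norm_minus_commute)
  with disc(2) show ?thesis by blast
qed

lemma disc_twist_in_chart:
  assumes "profile w" "x \<in> fst c"
  shows "disc_twist c q w x \<in> fst c" "snd c (disc_twist c q w x) = twist q w (snd c x)"
  using twist_in_chart[OF assms(1), of "snd c x"] assms(2)
  by (simp_all add: disc_twist_def inv_into_into f_inv_into_f)

lemma disc_twist_disc_twist:
  assumes "profile w" "profile w'"
  shows "disc_twist c q w (disc_twist c q w' x) = disc_twist c q (\<lambda>r. w r + w' r) x"
  using disc_twist_in_chart[OF assms(2), of x]
  by (cases "x \<in> fst c") (simp_all add: disc_twist_def[of c q w] disc_twist_def[of c q "\<lambda>r. w r + w' r"] twist_twist disc_twist_def[of c q w' x])

lemma disc_twist_zero: "disc_twist c q (\<lambda>r. 0) = id"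
  by (auto simp: disc_twist_def twist_fixed chart_inv[OF chart])

lemma disc_twist_funpow:
  assumes "profile w"
  shows "disc_twist c q w ^^ n = disc_twist c q (\<lambda>r. real n * w r)"
proof (induction n)
  case 0
  then show ?case by (simp add: disc_twist_zero)
next
  case (Suc n)
  then show ?case
    by (auto simp: disc_twist_disc_twist assms profile_mult distrib_right)
qed

lemma disc_twist_bij: "profile w \<Longrightarrow> bij (disc_twist c q w)"
  and disc_twist_inv: "profile w \<Longrightarrow> inv (disc_twist c q w) = disc_twist c q (\<lambda>r. - w r)"
proof -
  assume w: "profile w"
  then have "disc_twist c q w \<circ> disc_twist c q (\<lambda>r. - w r) = id" "disc_twist c q (\<lambda>r. - w r) \<circ> disc_twist c q w = id"
    by (auto simp: disc_twist_disc_twist profile_minus disc_twist_zero)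
  then show "bij (disc_twist c q w)" "inv (disc_twist c q w) = disc_twist c q (\<lambda>r. - w r)"
    by (simp_all add: o_bij inv_unique_comp)
qed

lemma disc_twist_outside:
  assumes "profile w" "x \<notin> fst c \<or> norm (snd c x - q) \<ge> \<rho>"
  shows "disc_twist c q w x = x"
  using assms by (auto simp: disc_twist_def profile_def twist_fixed chart_inv[OF chart])

text \<open>Continuity is glued over two open sets: the chart domain, and the complement of the
  disc, where the map is the identity. The disc is closed as a compact set in a Hausdorff
  space.\<close>

lemma disc_twist_continuous:
  assumes w: "profile w"
  shows "continuous_on UNIV (disc_twist c q w)"
proof -
  let ?\<psi> = "inv_into (fst c) (snd c)" and ?T = "disc_twist c q w"
  have "compact (?\<psi> ` cball q \<rho>)"
    by (intro compact_continuous_image continuous_on_subset[OF chart_inv_continuous[OF chart]] disc compact_cball)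
  then have open_outside: "open (- ?\<psi> ` cball q \<rho>)"
    by (intro open_Compl compact_imp_closed)
  have "continuous_on (fst c) (\<lambda>x. ?\<psi> (twist q w (snd c x)))"
    using w twist_in_chart[OF w]
    by (intro continuous_on_compose2[OF chart_inv_continuous[OF chart]]
        continuous_on_compose2[OF continuous_on_twist[of w UNIV] chart_continuous[OF chart]])
      (auto simp: profile_def)
  then have "continuous_on (fst c) ?T"
    by (rule continuous_on_eq) (simp add: disc_twist_def)
  moreover have fixed: "?T x = x" if "x \<in> - ?\<psi> ` cball q \<rho>" for x
  proof (rule disc_twist_outside[OF w], rule ccontr)
    assume "\<not> (x \<notin> fst c \<or> norm (snd c x - q) \<ge> \<rho>)"
    then have "x = ?\<psi> (snd c x)" "snd c x \<in> cball q \<rho>"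
      by (auto simp: chart_inv[OF chart] dist_norm norm_minus_commute)
    with that show False by blast
  qed
  have "continuous_on (- ?\<psi> ` cball q \<rho>) ?T"
    by (rule continuous_on_eq[OF continuous_on_id]) (simp add: fixed)
  moreover have "fst c \<union> - ?\<psi> ` cball q \<rho> = UNIV"
    using disc(2) by (auto intro: inv_into_into)
  ultimately show ?thesis
    using continuous_on_open_Un[OF chart_open[OF chart] open_outside] by metis
qed

lemma disc_twist_homeomorphism:
  assumes w: "profile w"
  shows "homeomorphism UNIV UNIV (disc_twist c q w) (inv (disc_twist c q w))"
  using disc_twist_continuous[OF w] disc_twist_continuous[OF profile_minus[OF w]] disc_twist_bij[OF w]
  unfolding homeomorphism_def disc_twist_inv[OF w, symmetric]
  by (auto simp: bij_is_inj bij_is_surj surj_f_inv_f bij_imp_bij_inv)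

text \<open>The set is split along the chart domain, which is invariant. Inside, the area-preserving
  chart transports the invariance of Lebesgue measure; outside, nothing moves.\<close>

lemma disc_twist_preserves:
  assumes w: "profile w" and M: "sets M = sets borel"
    and area: "\<And>B. B \<in> sets borel \<Longrightarrow> B \<subseteq> fst c \<Longrightarrow> emeasure lborel (snd c ` B) = emeasure M B"
    and B: "B \<in> sets borel"
  shows "emeasure M (disc_twist c q w ` B) = emeasure M B"
proof -
  let ?T = "disc_twist c q w"
  have U: "fst c \<in> sets borel" using chart_open[OF chart] by simp
  have image_borel: "?T ` X \<in> sets borel" if "X \<in> sets borel" for X
  proof -
    have "?T ` X = UNIV \<inter> inv ?T -` X"
      using disc_twist_bij[OF w] by (simp add: bij_vimage_eq_inv_image inv_inv_eq bij_imp_bij_inv)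
    also have "\<dots> \<in> sets borel"
      using disc_twist_continuous[OF profile_minus[OF w]] that
      by (intro continuous_on_vimage_borel) (simp_all add: disc_twist_inv[OF w])
    finally show ?thesis .
  qed
  have inside: "emeasure M (?T ` X) = emeasure M X" if X: "X \<in> sets borel" "X \<subseteq> fst c" for X
  proof -
    have "?T ` X \<subseteq> fst c"
      using X(2) disc_twist_in_chart(1)[OF w] by blast
    then have "emeasure M (?T ` X) = emeasure lborel (snd c ` ?T ` X)"
      using image_borel X(1) by (intro area[symmetric])
    \<comment> \<open>The image under a twist is the preimage under the opposite twist, the form in
      which invariance was proved.\<close>
    also have "snd c ` ?T ` X = twist q (\<lambda>r. - w r) -` (snd c ` X)"
    proof -
      have "snd c ` ?T ` X = twist q w ` snd c ` X"
        using X(2) disc_twist_in_chart(2)[OF w] by (force simp: image_image)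
      also have "\<dots> = twist q (\<lambda>r. - w r) -` (snd c ` X)"
      proof -
        have "twist q (\<lambda>r. - w r) (twist q w u) = u" "twist q w (twist q (\<lambda>r. - w r) u) = u" for u
          by (simp_all add: twist_twist twist_fixed)
        then show ?thesis by (auto intro: image_eqI[OF sym])
      qed
      finally show ?thesis .
    qed
    also have "emeasure lborel \<dots> = emeasure lborel (snd c ` X)"
      using profile_minus[OF w] X
      by (intro twist_preserves_lborel chart_image_borel[OF chart]) (simp_all add: profile_def)
    also have "\<dots> = emeasure M X" by (rule area[OF X])
    finally show ?thesis .
  qed
  have "?T ` B = ?T ` (B \<inter> fst c) \<union> (B - fst c)"
    using disc_twist_outside[OF w] by (force simp: image_iff)
  then have "emeasure M (?T ` B) = emeasure M (?T ` (B \<inter> fst c) \<union> (B - fst c))"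
    by (rule arg_cong)
  also have "\<dots> = emeasure M (?T ` (B \<inter> fst c)) + emeasure M (B - fst c)"
    using B U M image_borel disc_twist_in_chart(1)[OF w] by (intro plus_emeasure[symmetric]) auto
  also have "\<dots> = emeasure M (B \<inter> fst c) + emeasure M (B - fst c)"
    using B U by (subst inside) auto
  also have "\<dots> = emeasure M (B \<inter> fst c \<union> (B - fst c))"
    using B U M by (intro plus_emeasure) auto
  also have "B \<inter> fst c \<union> (B - fst c) = B" by blast
  finally show ?thesis .
qed

end

section \<open>Exponents\<close>

context riemannian_surface begin

text \<open>Only finitely many iterates, all continuous, are involved. Hence the supremum in the
  exponent sees every point close enough to \<open>x\<close>.\<close>

lemma dynamical_ball_eventually:
  assumes f: "continuous_on UNIV f" and "\<delta> > 0"
  shows "\<forall>\<^sub>F y in nhds x. y \<in> dynamical_ball dist_S f x \<delta> n"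
proof -
  have "continuous_on UNIV (f ^^ j)" for j
    by (induction j) (auto intro: continuous_on_compose2[OF f])
  then have "filterlim (f ^^ j) (nhds ((f ^^ j) x)) (nhds x)" for j
    by (simp add: continuous_on_eq_continuous_at isCont_def tendsto_at_iff_tendsto_nhds)
  then have "\<forall>\<^sub>F y in nhds x. dist_S ((f ^^ j) x) ((f ^^ j) y) < \<delta>" for j
    using eventually_compose_filterlim[OF dist_small[OF \<open>\<delta> > 0\<close>, of "(f ^^ j) x"]] by blast
  then have "\<forall>\<^sub>F y in nhds x. \<forall>j\<in>{..n}. dist_S ((f ^^ j) x) ((f ^^ j) y) < \<delta>"
    by (intro eventually_ball_finite) auto
  then show ?thesis
    by (simp add: dynamical_ball_def Ball_def)
qed

end

text \<open>For the identity and the twist the normalised logarithm is the same for all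
  \<open>n \<ge> 1\<close> and \<open>\<delta> > 0\<close>, so both limits are trivial. At
  \<open>n = 0\<close> the factor \<open>1 / real n\<close> is 0, which the limit superior
  ignores.\<close>

lemma top_exponent_eqI:
  assumes "\<And>n \<delta>. n \<ge> 1 \<Longrightarrow> \<delta> > 0 \<Longrightarrow> ereal (1 / real n) *
      elog (SUP y \<in> dynamical_ball d f x \<delta> n - {x}. ereal (diff_quot \<Phi> f n x y)) = L"
  shows "top_exponent d \<Phi> f x = L"
proof -
  let ?F = "\<lambda>n \<delta>. ereal (1 / real n) *
      elog (SUP y \<in> dynamical_ball d f x \<delta> n - {x}. ereal (diff_quot \<Phi> f n x y))"
  have "Lim (at_right 0) (?F n) = L" if "n \<ge> 1" for n
  proof (rule tendsto_Lim)
    have "\<forall>\<^sub>F \<delta> in at_right 0. ?F n \<delta> = L"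
      using eventually_at_right_less[of "0::real"] by (rule eventually_mono) (rule assms[OF that])
    then show "(?F n \<longlongrightarrow> L) (at_right 0)" by (rule tendsto_eventually)
  qed simp
  then have "\<forall>\<^sub>F n in sequentially. Lim (at_right 0) (?F n) = L"
    using eventually_ge_at_top[of 1] by (rule eventually_mono[rotated])
  then have "limsup (\<lambda>n. Lim (at_right 0) (?F n)) = limsup (\<lambda>n. L)"
    by (rule Limsup_eq)
  then show ?thesis by (simp add: top_exponent_def Limsup_const)
qed

lemma chart_at_mem:
  assumes "conservative_atlas \<A> M \<Phi>"
  obtains c where "c \<in> set \<Phi>" "x \<in> fst c" "chart_at \<Phi> x = snd c"
proof -
  let ?P = "\<lambda>i. i < length \<Phi> \<and> x \<in> fst (\<Phi> ! i)"
  obtain c where "c \<in> set \<Phi>" "x \<in> fst c"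
    using assms unfolding conservative_atlas_def by blast
  then have "\<exists>i. ?P i" by (metis in_set_conv_nth)
  then have "?P (LEAST i. ?P i)" by (rule LeastI_ex)
  then show thesis by (intro that[of "\<Phi> ! (LEAST i. ?P i)"]) (auto simp: chart_at_def)
qed

text \<open>The first nonempty chart of the list serves all of its points, so that no change of charts
  occurs in a difference quotient of a map supported there.\<close>

lemma first_chart:
  fixes \<Phi> :: "'a::topological_space chart list"
  assumes "conservative_atlas \<A> M \<Phi>"
  obtains c where "c \<in> set \<Phi>" "fst c \<noteq> {}" "\<And>x. x \<in> fst c \<Longrightarrow> chart_at \<Phi> x = snd c"
proof -
  let ?P = "\<lambda>i. i < length \<Phi> \<and> fst (\<Phi> ! i) \<noteq> {}"
  define i where "i = (LEAST i. ?P i)"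
  obtain c where "c \<in> set \<Phi>" "fst c \<noteq> {}"
    using assms unfolding conservative_atlas_def by blast
  then have "\<exists>i. ?P i" by (metis in_set_conv_nth)
  then have i: "?P i" unfolding i_def by (rule LeastI_ex)
  have "(LEAST j. j < length \<Phi> \<and> x \<in> fst (\<Phi> ! j)) = i" if "x \<in> fst (\<Phi> ! i)" for x
    using i that by (intro Least_equality) (auto simp: i_def intro: Least_le)
  with i show thesis by (intro that[of "\<Phi> ! i"]) (auto simp: chart_at_def)
qed

section \<open>Exponents of the identity and of the twist\<close>

locale conservative_surface = riemannian_surface \<A> G
  for \<A> :: "'a::t2_space chart set" and G +
  fixes M :: "'a measure" and \<Phi> :: "'a chart list"
  assumes sets_M: "sets M = sets borel" and conservative: "conservative_atlas \<A> M \<Phi>"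
begin

lemma conservative_chart: "c \<in> set \<Phi> \<Longrightarrow> smooth_chart \<A> c" "c \<in> set \<Phi> \<Longrightarrow> is_chart c"
  and conservative_area:
    "c \<in> set \<Phi> \<Longrightarrow> B \<in> sets borel \<Longrightarrow> B \<subseteq> fst c \<Longrightarrow> emeasure lborel (snd c ` B) = emeasure M B"
  using conservative unfolding conservative_atlas_def smooth_chart_def by blast+

lemma top_exponent_id: "top_exponent dist_S \<Phi> id x = 0"
proof (rule top_exponent_eqI)
  fix n :: nat and \<delta> :: real
  assume "n \<ge> 1" "\<delta> > 0"
  obtain c where c: "c \<in> set \<Phi>" "x \<in> fst c" "chart_at \<Phi> x = snd c"
    by (rule chart_at_mem[OF conservative])
  note ic = conservative_chart(2)[OF c(1)]
  let ?B = "dynamical_ball dist_S id x \<delta> n - {x}" and ?\<psi> = "inv_into (fst c) (snd c)"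
  obtain e where e: "e > 0"
    "\<And>v. dist v (snd c x) < e \<Longrightarrow> v \<in> snd c ` fst c \<and> ?\<psi> v \<in> dynamical_ball dist_S id x \<delta> n"
    by (rule chart_eventually[OF ic c(2) dynamical_ball_eventually[OF continuous_on_id' \<open>\<delta> > 0\<close>]]) blast
  \<comment> \<open>A second point of the ball is needed for the value 1: over an empty set the
    supremum would be \<open>-\<infinity>\<close>.\<close>
  define v where "v = snd c x + (e / 2) *\<^sub>R axis 1 1"
  have "dist v (snd c x) = e / 2"
    using e(1) by (simp add: v_def dist_norm)
  then have v: "v \<in> snd c ` fst c" "?\<psi> v \<in> dynamical_ball dist_S id x \<delta> n" "v \<noteq> snd c x"
    using e by auto
  then have "?\<psi> v \<in> ?B" "snd c (?\<psi> v) = v"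
    by (auto simp: f_inv_into_f)
  \<comment> \<open>Numerator and denominator coincide. The quotient is 1, or 0 by division by zero
    where the chart function does not separate \<open>y\<close> from \<open>x\<close>, as may happen
    outside the chart domain.\<close>
  moreover have "diff_quot \<Phi> id n x y \<le> 1" for y
    by (simp add: diff_quot_def id_def[symmetric])
  moreover have "diff_quot \<Phi> id n x (?\<psi> v) = 1"
    using v(3) \<open>snd c (?\<psi> v) = v\<close> by (simp add: diff_quot_def c(3) id_def[symmetric])
  ultimately have "(SUP y \<in> ?B. ereal (diff_quot \<Phi> id n x y)) = 1"
    by (intro antisym SUP_least SUP_upper2[of "?\<psi> v"]) (auto simp: one_ereal_def)
  then show "ereal (1 / real n) * elog (SUP y \<in> ?B. ereal (diff_quot \<Phi> id n x y)) = 0"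
    by (simp add: elog_def)
qed

lemma integrated_exponent_id: "integrated_exponent dist_S \<Phi> M id = 0"
  by (simp add: integrated_exponent_def ereal_integral_def top_exponent_id zero_ennreal.rep_eq
      e2ennreal_neg flip: zero_ereal_def)

lemma id_Hom: "id \<in> Hom M"
  by (simp add: Hom_def homeomorphism_def inv_id)

lemma openin_Hom_topology:
  "openin (Hom_topology dist_S M) U \<longleftrightarrow> U \<subseteq> Hom M
    \<and> (\<forall>f\<in>U. \<exists>r>0. \<forall>g\<in>Hom M. C0_dist dist_S f g < r \<longrightarrow> g \<in> U)"
proof -
  interpret Metric_space "Hom M" "C0_dist dist_S"
    by (rule Metric_space_C0_dist)
  show ?thesis
    unfolding Hom_topology_def openin_mtopology mball_def by blast
qed

lemma topspace_Hom_topology: "topspace (Hom_topology dist_S M) = Hom M"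
proof -
  interpret Metric_space "Hom M" "C0_dist dist_S"
    by (rule Metric_space_C0_dist)
  show ?thesis unfolding Hom_topology_def by simp
qed

lemma exists_small_infinite_exponent:
  assumes "r > 0"
  shows "\<exists>g \<in> Hom M. C0_dist dist_S id g < r \<and> integrated_exponent dist_S \<Phi> M g = \<infinity>"
proof -
  obtain W :: "real \<Rightarrow> real" where W: "continuous_on UNIV W"
    "\<And>x K e. e > 0 \<Longrightarrow> \<exists>y. \<bar>y - x\<bar> < e \<and> K * \<bar>y - x\<bar> < \<bar>W y - W x\<bar>"
    by (rule exists_continuous_nowhere_Lipschitz) blast
  obtain c where c: "c \<in> set \<Phi>" "fst c \<noteq> {}" "\<And>x. x \<in> fst c \<Longrightarrow> chart_at \<Phi> x = snd c"
    by (rule first_chart[OF conservative]) blast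
  note ic = conservative_chart(2)[OF c(1)]
  obtain p where p: "p \<in> fst c" using c(2) by blast
  define q where "q = snd c p"
  let ?\<psi> = "inv_into (fst c) (snd c)"
  obtain R C where R: "R > 0" "C \<ge> 0" "cball q R \<subseteq> snd c ` fst c"
    and le: "\<And>u v. u \<in> cball q R \<Longrightarrow> v \<in> cball q R \<Longrightarrow> edist (?\<psi> u) (?\<psi> v) \<le> ennreal (C * norm (v - u))"
    unfolding q_def by (rule segment_edist_le[OF conservative_chart(1)[OF c(1)] p]) blast
  \<comment> \<open>Points of the disc move by at most \<open>2 * \<rho>\<close> in coordinates,
    hence by at most \<open>r / 2\<close> on the surface. \<open>C + 1\<close> guards against
    \<open>C = 0\<close>.\<close>
  define \<rho> where "\<rho> = min R (r / (4 * (C + 1)))"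
  have \<rho>: "\<rho> > 0" "\<rho> \<le> R" using R assms by (auto simp: \<rho>_def)
  have "C * (2 * \<rho>) \<le> (C + 1) * (2 * (r / (4 * (C + 1))))"
    using R(2) \<rho>(1) by (intro mult_mono) (auto simp: \<rho>_def)
  also have "\<dots> = r / 2" using R(2) by (simp add: field_simps)
  finally have C\<rho>: "C * (2 * \<rho>) \<le> r / 2" .
  interpret chart_disc c q \<rho>
    using ic \<rho> R(3) by unfold_locales (auto intro: order_trans[OF subset_cball])
  define w where "w s = W (min s \<rho>) - W \<rho>" for s
  have w: "profile w"
    unfolding profile_def w_def
    by (auto intro!: continuous_intros continuous_on_compose2[OF W(1)] simp: min_absorb2)
  have steep: "\<exists>y. \<bar>y - s\<bar> < e \<and> K * \<bar>y - s\<bar> < \<bar>w y - w s\<bar>" if "s < \<rho>" "e > 0" for s K e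
    using W(2)[of "min e (\<rho> - s)" s K] that by (fastforce simp: w_def)
  define g where "g = disc_twist c q w"
  have "g \<in> Hom M"
    unfolding Hom_def g_def
    using disc_twist_homeomorphism[OF w] disc_twist_preserves[OF w sets_M conservative_area[OF c(1)]] by simp
  moreover have "C0_dist dist_S id g < r"
  proof -
    \<comment> \<open>Stated for all profiles because \<open>C0_dist\<close> also compares inverses,
      and the inverse is the twist by the opposite profile.\<close>
    have close: "dist_S x (disc_twist c q v x) \<le> r / 2" if v: "profile v" for v x
    proof (cases "x \<notin> fst c \<or> norm (snd c x - q) \<ge> \<rho>")
      case True
      then show ?thesis using disc_twist_outside[OF v True] assms by simp
    next
      case False
      let ?u = "snd c x"
      have u: "norm (?u - q) < \<rho>" "norm (twist q v ?u - q) < \<rho>" using False by simp_all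
      then have "norm (twist q v ?u - ?u) \<le> 2 * \<rho>"
        using norm_triangle_ineq4[of "twist q v ?u - q" "?u - q"] by simp
      then have "C * norm (twist q v ?u - ?u) \<le> r / 2"
        using C\<rho> R(2) by (meson mult_left_mono order_trans)
      then have "ennreal (C * norm (twist q v ?u - ?u)) \<le> ennreal (r / 2)"
        by (rule ennreal_leI)
      moreover have "edist (?\<psi> ?u) (?\<psi> (twist q v ?u)) \<le> ennreal (C * norm (twist q v ?u - ?u))"
        using u \<rho>(2) by (intro le) (simp_all add: dist_norm norm_minus_commute)
      ultimately have "edist (?\<psi> ?u) (?\<psi> (twist q v ?u)) \<le> ennreal (r / 2)"
        by (rule order_trans[rotated])
      then have "ennreal (dist_S x (disc_twist c q v x)) \<le> ennreal (r / 2)"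
        using False by (simp add: ennreal_dist chart_inv[OF ic] disc_twist_def)
      then show ?thesis using assms by simp
    qed
    have "C0_dist dist_S id g \<le> r / 2"
      unfolding g_def using close[OF w] close[OF profile_minus[OF w]]
      by (intro C0_dist_least) (simp_all add: disc_twist_inv[OF w] inv_id)
    then show ?thesis using assms by simp
  qed
  moreover have "integrated_exponent dist_S \<Phi> M g = \<infinity>"
  proof -
    \<comment> \<open>The centre is removed: it is fixed, and the argument by angular displacement
      needs a positive radius.\<close>
    let ?D = "?\<psi> ` (ball q \<rho> - {q})"
    have D_sub: "ball q \<rho> - {q} \<subseteq> snd c ` fst c"
      using disc(2) ball_subset_cball by blast
    have exponent: "top_exponent dist_S \<Phi> g x = \<infinity>" if xD: "x \<in> ?D" for x
    proof (rule top_exponent_eqI)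
      obtain u where u: "u \<in> ball q \<rho>" "u \<noteq> q" "u \<in> snd c ` fst c" "x = ?\<psi> u"
        using xD D_sub by blast
      then have x: "x \<in> fst c" "snd c x = u" by (auto simp: inv_into_into f_inv_into_f)
      fix n :: nat and \<delta> :: real
      assume n: "n \<ge> 1" and "\<delta> > 0"
      let ?B = "dynamical_ball dist_S g x \<delta> n"
      let ?T = "twist q (\<lambda>r. real n * w r)"
      obtain e where e: "e > 0" "\<And>v. dist v (snd c x) < e \<Longrightarrow> v \<in> snd c ` fst c \<and> ?\<psi> v \<in> ?B"
        by (rule chart_eventually[OF ic x(1) dynamical_ball_eventually[OF disc_twist_continuous[OF w] \<open>\<delta> > 0\<close>]])
          (use g_def in blast)
      have gn: "(g ^^ n) y \<in> fst c" "snd c ((g ^^ n) y) = ?T (snd c y)" if "y \<in> fst c" for y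
        unfolding g_def disc_twist_funpow[OF w]
        using disc_twist_in_chart[OF profile_mult[OF w] that] by auto
      have "\<exists>y \<in> ?B - {x}. ereal (real m) \<le> ereal (diff_quot \<Phi> g n x y)" for m
      proof -
        have "norm (u - q) < \<rho>"
          using u(1) by (simp add: dist_norm norm_minus_commute)
        then have "\<exists>v. dist v u < e \<and> real m * norm (u - v) < norm (?T u - ?T v)"
          using w n e(1) by (intro twist_not_Lipschitz u(2) steep) (auto simp: profile_def)
        then obtain v where v: "dist v u < e" "real m * norm (u - v) < norm (?T u - ?T v)"
          by blast
        then have "v \<noteq> u" by auto
        have "v \<in> snd c ` fst c" "?\<psi> v \<in> ?B" using e(2) v(1) x(2) by auto
        then have y: "?\<psi> v \<in> fst c" "snd c (?\<psi> v) = v" "?\<psi> v \<in> ?B"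
          by (simp_all add: inv_into_into f_inv_into_f)
        \<comment> \<open>Since \<open>x\<close> and its \<open>n\<close>-th image both lie in the
          first nonempty chart, numerator and denominator are computed in the same
          coordinates.\<close>
        have "diff_quot \<Phi> g n x (?\<psi> v) = norm (?T u - ?T v) / norm (u - v)"
          using c(3)[OF x(1)] c(3)[OF gn(1)[OF x(1)]]
          by (simp add: diff_quot_def gn(2) x y)
        moreover have "norm (u - v) > 0" using \<open>v \<noteq> u\<close> by simp
        ultimately have "real m \<le> diff_quot \<Phi> g n x (?\<psi> v)"
          using v(2) by (simp add: pos_le_divide_eq)
        moreover have "?\<psi> v \<noteq> x" using y(2) x(2) \<open>v \<noteq> u\<close> by auto
        ultimately show ?thesis using y(3) by auto
      qed
      then have "(SUP y \<in> ?B - {x}. ereal (diff_quot \<Phi> g n x y)) = \<infinity>"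
        by (rule SUP_PInfty)
      then show "ereal (1 / real n) * elog (SUP y \<in> ?B - {x}. ereal (diff_quot \<Phi> g n x y)) = \<infinity>"
        using n by (simp add: elog_def)
    qed
    have "open ?D"
      by (intro chart_inv_open_map[OF ic] D_sub open_Diff) auto
    then have D: "?D \<in> sets borel" "?D \<subseteq> fst c"
      using D_sub by (auto intro: inv_into_into)
    have "snd c ` ?D = ball q \<rho> - {q}"
      using D_sub by (force simp: image_image f_inv_into_f)
    then have "emeasure M ?D = emeasure lborel (ball q \<rho> - {q})"
      using conservative_area[OF c(1) D] by simp
    also have "\<dots> \<noteq> 0"
    proof
      assume "emeasure lborel (ball q \<rho> - {q}) = 0"
      then have "negligible (ball q \<rho> - {q})"
        unfolding negligible_iff_null_sets by (intro null_sets_completionI) (simp add: null_sets_def)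
      moreover have "q + (\<rho> / 2) *\<^sub>R axis 1 1 \<in> ball q \<rho> - {q}"
        using \<rho>(1) by (simp add: dist_norm axis_eq_0_iff)
      ultimately show False
        using open_not_negligible[of "ball q \<rho> - {q}"] by blast
    qed
    finally have "(\<integral>\<^sup>+ x. \<infinity> * indicator ?D x \<partial>M) = \<infinity>"
      using D(1) sets_M by (subst nn_integral_cmult_indicator) (simp_all add: ennreal_top_mult)
    \<comment> \<open>Measurability of the exponent is not established; monotonicity of the integral
      suffices.\<close>
    moreover have "(\<integral>\<^sup>+ x. \<infinity> * indicator ?D x \<partial>M) \<le> (\<integral>\<^sup>+ x. e2ennreal (top_exponent dist_S \<Phi> g x) \<partial>M)"
      using exponent by (intro nn_integral_mono) (auto split: split_indicator)
    ultimately have "(\<integral>\<^sup>+ x. e2ennreal (top_exponent dist_S \<Phi> g x) \<partial>M) = \<infinity>"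
      by (simp add: top_unique)
    \<comment> \<open>In \<^typ>\<open>ereal\<close>, \<open>\<infinity> - a = \<infinity>\<close> even for \<open>a = \<infinity>\<close>, so the negative part is irrelevant.\<close>
    then show ?thesis
      by (simp add: integrated_exponent_def ereal_integral_def)
  qed
  ultimately show ?thesis by blast
qed

end

theorem theorem3:
  fixes \<A> :: "'a::t2_space chart set"
    and G :: "'a chart \<Rightarrow> real^2 \<Rightarrow> real^2^2"
    and \<omega> :: "'a chart \<Rightarrow> real^2 \<Rightarrow> real"
    and lam :: "'a measure"
    and \<Phi> :: "'a chart list"
  assumes "compact (UNIV :: 'a set)"
    and "connected (UNIV :: 'a set)"
    and "smooth_atlas \<A>"
    and "riemannian_metric \<A> G"
    and "area_form \<A> \<omega>"
    and "induced_measure \<A> \<omega> lam"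
    and "conservative_atlas \<A> lam \<Phi>"
  shows "\<not> upper_semicontinuous_map (Hom_topology (rdist \<A> G) lam)
            (integrated_exponent (rdist \<A> G) \<Phi> lam)"
proof
  interpret conservative_surface \<A> G lam \<Phi>
    using assms by unfold_locales (auto simp: induced_measure_def)
  let ?L = "integrated_exponent dist_S \<Phi> lam"
  \<comment> \<open>Any positive threshold would serve, as the values to separate are 0 and
    \<open>\<infinity>\<close>.\<close>
  let ?U = "{h \<in> topspace (Hom_topology dist_S lam). ?L h < 1}"
  assume "upper_semicontinuous_map (Hom_topology dist_S lam) ?L"
  then have "openin (Hom_topology dist_S lam) ?U"
    unfolding upper_semicontinuous_map_def by blast
  moreover have "id \<in> ?U"
    by (simp add: topspace_Hom_topology id_Hom integrated_exponent_id)
  ultimately obtain r where "r > 0" "\<And>g. g \<in> Hom lam \<Longrightarrow> C0_dist dist_S id g < r \<Longrightarrow> ?L g < 1"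
    unfolding openin_Hom_topology by blast
  then show False
    using exists_small_infinite_exponent[of r] by fastforce
qed

end
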